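(* Let $A$ be a C*-algebra, not assumed to have a unit, such that every maximal abelian self-adjoint subalgebra of $A$ is monotone complete. Then $A$ has a unit and $A$ is an AW*-algebra.
   Context: A C*-algebra $B$ (unital or not) is monotone complete if every norm-bounded, upward directed subset of $B_{sa}$ has a supremum in $B_{sa}$ (for a maximal abelian self-adjoint subalgebra $M$, suprema are taken in $M_{sa}$). A C*-algebra $A$ is an AW*-algebra if (i) each maximal abelian self-adjoint subalgebra of $A$ is norm generated by its projections, and (ii) each family of mutually orthogonal projections in $A$ has a least upper bound in $\mathrm{Proj}(A)$, the set of projections of $A$ with the order inherited from $A_{sa}$. *)

theory Defs
  imports "HOL-Analysis.Analysis"
begin

text \<open>A (possibly non-unital) C*-algebra: the carrier is a type 'a which is a real Banach
  algebra (class real_normed_algebra does not require a unit), equipped with a complex scalar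
  multiplication sc extending scaleR and an involution st satisfying the C*-identity.\<close>

definition cstar_algebra :: "(complex \<Rightarrow> 'a::{banach, real_normed_algebra} \<Rightarrow> 'a) \<Rightarrow> ('a \<Rightarrow> 'a) \<Rightarrow> bool"
  where "cstar_algebra sc st \<longleftrightarrow>
    (\<forall>r x. sc (complex_of_real r) x = scaleR r x) \<and>
    (\<forall>a b x. sc (a + b) x = sc a x + sc b x) \<and>
    (\<forall>a x y. sc a (x + y) = sc a x + sc a y) \<and>
    (\<forall>a b x. sc a (sc b x) = sc (a * b) x) \<and>
    (\<forall>a x. norm (sc a x) = cmod a * norm x) \<and>
    (\<forall>a x y. sc a (x * y) = sc a x * y \<and> sc a (x * y) = x * sc a y) \<and>
    (\<forall>x y. st (x + y) = st x + st y) \<and>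
    (\<forall>a x. st (sc a x) = sc (cnj a) (st x)) \<and>
    (\<forall>x y. st (x * y) = st y * st x) \<and>
    (\<forall>x. st (st x) = x) \<and>
    (\<forall>x. norm (st x * x) = (norm x)\<^sup>2)"

definition star_subalg :: "(complex \<Rightarrow> 'a \<Rightarrow> 'a) \<Rightarrow> ('a \<Rightarrow> 'a) \<Rightarrow> 'a::real_normed_algebra set \<Rightarrow> bool"
  where "star_subalg sc st B \<longleftrightarrow> 0 \<in> B \<and> (\<forall>x\<in>B. \<forall>y\<in>B. x + y \<in> B \<and> x * y \<in> B) \<and>
     (\<forall>c. \<forall>x\<in>B. sc c x \<in> B) \<and> (\<forall>x\<in>B. st x \<in> B)"

definition abelian :: "'a::real_normed_algebra set \<Rightarrow> bool"
  where "abelian B \<longleftrightarrow> (\<forall>x\<in>B. \<forall>y\<in>B. x * y = y * x)"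

definition masa :: "(complex \<Rightarrow> 'a \<Rightarrow> 'a) \<Rightarrow> ('a \<Rightarrow> 'a) \<Rightarrow> 'a::real_normed_algebra set \<Rightarrow> bool"
  where "masa sc st M \<longleftrightarrow> star_subalg sc st M \<and> abelian M \<and>
     (\<forall>N. star_subalg sc st N \<and> abelian N \<and> M \<subseteq> N \<longrightarrow> N = M)"

definition positive :: "('a \<Rightarrow> 'a) \<Rightarrow> 'a::real_normed_algebra \<Rightarrow> bool"
  where "positive st a \<longleftrightarrow> (\<exists>b. a = st b * b)"

definition cstar_le :: "('a \<Rightarrow> 'a) \<Rightarrow> 'a::real_normed_algebra \<Rightarrow> 'a \<Rightarrow> bool"
  where "cstar_le st x y \<longleftrightarrow> positive st (y - x)"

definition sa_part :: "('a \<Rightarrow> 'a) \<Rightarrow> 'a set \<Rightarrow> 'a set"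
  where "sa_part st B = {x \<in> B. st x = x}"

definition directed_up :: "('a \<Rightarrow> 'a \<Rightarrow> bool) \<Rightarrow> 'a set \<Rightarrow> bool"
  where "directed_up le D \<longleftrightarrow> D \<noteq> {} \<and> (\<forall>x\<in>D. \<forall>y\<in>D. \<exists>z\<in>D. le x z \<and> le y z)"

definition is_sup_in :: "('a \<Rightarrow> 'a \<Rightarrow> bool) \<Rightarrow> 'a set \<Rightarrow> 'a set \<Rightarrow> 'a \<Rightarrow> bool"
  where "is_sup_in le S D s \<longleftrightarrow> s \<in> S \<and> (\<forall>d\<in>D. le d s) \<and>
     (\<forall>u\<in>S. (\<forall>d\<in>D. le d u) \<longrightarrow> le s u)"

definition monotone_complete :: "('a \<Rightarrow> 'a) \<Rightarrow> 'a::real_normed_algebra set \<Rightarrow> bool"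
  where "monotone_complete st B \<longleftrightarrow>
     (\<forall>D. D \<subseteq> sa_part st B \<and> bounded D \<and> directed_up (cstar_le st) D \<longrightarrow>
        (\<exists>s. is_sup_in (cstar_le st) (sa_part st B) D s))"

definition projections :: "('a \<Rightarrow> 'a) \<Rightarrow> 'a::real_normed_algebra set"
  where "projections st = {p. p * p = p \<and> st p = p}"

definition cstar_generated :: "(complex \<Rightarrow> 'a \<Rightarrow> 'a) \<Rightarrow> ('a \<Rightarrow> 'a) \<Rightarrow> 'a::real_normed_algebra set \<Rightarrow> 'a set"
  where "cstar_generated sc st S = \<Inter>{B. star_subalg sc st B \<and> closed B \<and> S \<subseteq> B}"

definition has_unit :: "'a::real_normed_algebra itself \<Rightarrow> bool"
  where "has_unit _ \<longleftrightarrow> (\<exists>e::'a. \<forall>x. e * x = x \<and> x * e = x)"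

definition aw_star :: "(complex \<Rightarrow> 'a::real_normed_algebra \<Rightarrow> 'a) \<Rightarrow> ('a \<Rightarrow> 'a) \<Rightarrow> bool"
  where "aw_star sc st \<longleftrightarrow>
    (\<forall>M. masa sc st M \<longrightarrow> M = cstar_generated sc st (projections st \<inter> M)) \<and>
    (\<forall>P. P \<subseteq> projections st \<and> (\<forall>p\<in>P. \<forall>q\<in>P. p \<noteq> q \<longrightarrow> p * q = 0) \<longrightarrow>
       (\<exists>e. is_sup_in (cstar_le st) (projections st) P e))"

end

theory Submission
  imports Defs
begin

text \<open>
A projection \<open>e\<close> in a monotone complete maximal abelian subalgebra \<open>M\<close> arises as the supremum of an
approximate unit: from \<open>e u \<ge> u\<close> for the members \<open>u\<close> of the approximate unit it follows that
\<open>e - c e (e - 1)\<^sup>2\<close> is again an upper bound, so \<open>e (e - 1)\<^sup>2 = 0\<close>. In this way each positive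
\<open>b \<in> M\<close> has a support projection in \<open>M\<close>, and each orthogonal family of projections in \<open>M\<close> has a
supremum there which is a projection.

If \<open>R\<close> is a maximal orthogonal family of projections of \<open>A\<close> and \<open>x R = 0\<close>, then \<open>x\<^sup>* x\<close> commutes with
\<open>R\<close>, and its support projection in a maximal abelian subalgebra containing \<open>R\<close> and \<open>x\<^sup>* x\<close> is
orthogonal to \<open>R\<close>; hence \<open>x = 0\<close>. So the supremum \<open>u\<close> of \<open>R\<close> in any maximal abelian subalgebra containing
\<open>R\<close> is a unit, as \<open>(x - x u) R = 0\<close>. For an orthogonal family \<open>P\<close>, choose \<open>R \<supseteq> P\<close> and let \<open>e\<close> be the
supremum of \<open>P\<close> in a maximal abelian subalgebra containing \<open>R\<close>. Then \<open>x P = 0\<close> implies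
\<open>x e R = 0\<close>, thus \<open>x e = 0\<close>, which makes \<open>e\<close> the least projection above \<open>P\<close> in all of \<open>A\<close>. Finally, a
contraction \<open>0 \<le> x \<le> 1\<close> in \<open>M\<close> has a dyadic expansion into projections, whose first digit is the
support of the positive part of \<open>2 x - 1\<close>.

Positivity is handled without spectral theory: \<open>T \<ge> 0\<close> means \<open>\<parallel>t - T\<parallel> \<le> t\<close> for some \<open>t\<close>.
\<close>

section \<open>The unitization\<close>

text \<open>Real scalars suffice, since positivity is tested on the real shifts
  \<open>of_real t - T\<close>; complex multiples are taken inside the algebra through
  \<open>sc\<close>. The sum norm makes the unitization a Banach algebra at once.\<close>

datatype 'a unitization = Unz (scl: real) (elt: 'a)

lemma unitization_eq_iff: "x = y \<longleftrightarrow> scl x = scl y \<and> elt x = elt y"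
  by (cases x; cases y) auto

instantiation unitization :: (real_normed_algebra) real_normed_algebra_1
begin

definition "zero_unitization = Unz 0 0"
definition "one_unitization = Unz 1 0"
definition "plus_unitization x y = Unz (scl x + scl y) (elt x + elt y)"
definition "minus_unitization x y = Unz (scl x - scl y) (elt x - elt y)"
definition "uminus_unitization x = Unz (- scl x) (- elt x)"
definition "times_unitization x y =
  Unz (scl x * scl y) (scl x *\<^sub>R elt y + scl y *\<^sub>R elt x + elt x * elt y)"
definition "scaleR_unitization r x = Unz (r * scl x) (r *\<^sub>R elt x)"
definition "norm_unitization x = \<bar>scl x\<bar> + norm (elt x)"
definition "sgn_unitization x = scaleR (inverse (norm x)) x" for x :: "'a unitization"
definition "dist_unitization x y = norm (x - y)" for x y :: "'a unitization"
definition "(uniformity :: ('a unitization \<times> 'a unitization) filter)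
  = (INF e\<in>{0<..}. principal {(x, y). dist x y < e})"
definition "open_unitization S = (\<forall>x\<in>S. \<forall>\<^sub>F (x', y) in uniformity. x' = x \<longrightarrow> y \<in> S)"
  for S :: "'a unitization set"

instance
proof
  fix x y z :: "'a unitization" and a b :: real
  note defs = zero_unitization_def one_unitization_def plus_unitization_def minus_unitization_def
    uminus_unitization_def times_unitization_def scaleR_unitization_def norm_unitization_def
    unitization_eq_iff
  show "x + y + z = x + (y + z)" "x + y = y + x" "0 + x = x" "- x + x = 0" "x - y = x + - y"
    "a *\<^sub>R (x + y) = a *\<^sub>R x + a *\<^sub>R y" "(a + b) *\<^sub>R x = a *\<^sub>R x + b *\<^sub>R x"
    "a *\<^sub>R b *\<^sub>R x = (a * b) *\<^sub>R x" "1 *\<^sub>R x = x"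
    "1 * x = x" "x * 1 = x" "(0::'a unitization) \<noteq> 1" "norm (1 :: 'a unitization) = 1"
    by (simp_all add: defs algebra_simps)
  show "x * y * z = x * (y * z)" "(x + y) * z = x * z + y * z" "x * (y + z) = x * y + x * z"
    "a *\<^sub>R x * y = a *\<^sub>R (x * y)" "x * a *\<^sub>R y = a *\<^sub>R (x * y)"
    by (simp_all add: defs algebra_simps scaleR_add_right scaleR_add_left)
  show "norm x = 0 \<longleftrightarrow> x = 0"
    by (simp add: defs add_nonneg_eq_0_iff)
  show "norm (a *\<^sub>R x) = \<bar>a\<bar> * norm x"
    by (simp add: defs abs_mult algebra_simps)
  show "norm (x + y) \<le> norm x + norm y"
    using norm_triangle_ineq[of "elt x" "elt y"] by (simp add: defs)
  have "norm (scl x *\<^sub>R elt y + scl y *\<^sub>R elt x + elt x * elt y)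
      \<le> \<bar>scl x\<bar> * norm (elt y) + \<bar>scl y\<bar> * norm (elt x) + norm (elt x) * norm (elt y)"
    by (intro order_trans[OF norm_triangle_ineq] add_mono norm_mult_ineq) simp_all
  then show "norm (x * y) \<le> norm x * norm y"
    by (simp add: defs abs_mult algebra_simps)
  show "sgn x = scaleR (inverse (norm x)) x" "dist x y = norm (x - y)"
    by (simp_all add: sgn_unitization_def dist_unitization_def)
qed (simp_all add: uniformity_unitization_def open_unitization_def)

end

lemma scl_simps [simp]:
  "scl 0 = 0" "scl 1 = 1" "scl (x + y) = scl x + scl y" "scl (x - y) = scl x - scl y"
  "scl (- x) = - scl x" "scl (x * y) = scl x * scl y" "scl (r *\<^sub>R x) = r * scl x"
  by (simp_all add: zero_unitization_def one_unitization_def plus_unitization_def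
      minus_unitization_def uminus_unitization_def times_unitization_def scaleR_unitization_def)

lemma scl_power [simp]: "scl (x ^ n) = scl x ^ n"
  by (induction n) simp_all

lemma scl_of_real [simp]: "scl (of_real r) = r"
  by (simp add: of_real_def)

lemma elt_simps [simp]:
  "elt 0 = 0" "elt 1 = 0" "elt (x + y) = elt x + elt y" "elt (x - y) = elt x - elt y"
  "elt (- x) = - elt x" "elt (r *\<^sub>R x) = r *\<^sub>R elt x" "elt (of_real r) = 0"
  by (simp_all add: zero_unitization_def one_unitization_def plus_unitization_def of_real_def
      minus_unitization_def uminus_unitization_def times_unitization_def scaleR_unitization_def)

lemma elt_mult: "elt (x * y) = scl x *\<^sub>R elt y + scl y *\<^sub>R elt x + elt x * elt y"
  by (simp add: times_unitization_def)

lemma norm_unitization: "norm x = \<bar>scl x\<bar> + norm (elt x)"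
  by (simp add: norm_unitization_def)

lemma bounded_linear_scl: "bounded_linear scl"
  by (rule bounded_linear_intro[of _ 1]) (simp_all add: norm_unitization)

lemma bounded_linear_elt: "bounded_linear elt"
  by (rule bounded_linear_intro[of _ 1]) (simp_all add: norm_unitization)

instance unitization :: ("{banach, real_normed_algebra}") banach
proof
  fix X :: "nat \<Rightarrow> 'a unitization"
  assume X: "Cauchy X"
  obtain s where s: "(\<lambda>n. scl (X n)) \<longlonglongrightarrow> s"
    using bounded_linear.Cauchy[OF bounded_linear_scl X] Cauchy_convergent convergent_def by blast
  obtain v where v: "(\<lambda>n. elt (X n)) \<longlonglongrightarrow> v"
    using bounded_linear.Cauchy[OF bounded_linear_elt X] Cauchy_convergent convergent_def by blast
  have "(\<lambda>n. \<bar>scl (X n) - s\<bar> + norm (elt (X n) - v)) \<longlonglongrightarrow> \<bar>s - s\<bar> + norm (v - v)"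
    by (intro tendsto_intros s v)
  then have "(\<lambda>n. norm (X n - Unz s v)) \<longlonglongrightarrow> 0"
    by (simp add: norm_unitization)
  then have "X \<longlonglongrightarrow> Unz s v"
    using LIM_zero_iff tendsto_norm_zero_iff by blast
  then show "convergent X"
    by (auto simp: convergent_def)
qed

definition emb :: "'a::real_normed_algebra \<Rightarrow> 'a unitization"
  where "emb x = Unz 0 x"

lemma scl_emb [simp]: "scl (emb x) = 0" and elt_emb [simp]: "elt (emb x) = x"
  by (simp_all add: emb_def)

lemma norm_emb [simp]: "norm (emb x) = norm x"
  by (simp add: norm_unitization)

lemma emb_simps:
  "emb 0 = 0" "emb (x + y) = emb x + emb y" "emb (x - y) = emb x - emb y" "emb (- x) = - emb x"
  "emb (x * y) = emb x * emb y" "emb (r *\<^sub>R x) = r *\<^sub>R emb x"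
  by (simp_all add: unitization_eq_iff elt_mult)

lemma emb_eq_iff [simp]: "emb x = emb y \<longleftrightarrow> x = y"
  by (simp add: emb_def)

lemma emb_eq_0_iff [simp]: "emb x = 0 \<longleftrightarrow> x = 0"
  by (simp add: unitization_eq_iff)

lemma emb_elt: "scl x = 0 \<Longrightarrow> emb (elt x) = x"
  by (simp add: unitization_eq_iff)

section \<open>Bicommutants of single elements\<close>

text \<open>The bicommutant of \<open>T\<close>. It takes the place of a functional calculus:
  whatever is constructed from \<open>T\<close> by polynomials and limits stays in it, and hence
  commutes with all that commutes with \<open>T\<close>.\<close>

definition dcomm :: "'a::ring_1 \<Rightarrow> 'a \<Rightarrow> bool"
  where "dcomm T r \<longleftrightarrow> (\<forall>c. c * T = T * c \<longrightarrow> c * r = r * c)"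

lemma dcommD: "dcomm T r \<Longrightarrow> c * T = T * c \<Longrightarrow> c * r = r * c"
  by (simp add: dcomm_def)

lemma dcomm_self [simp]: "dcomm T T"
  by (simp add: dcomm_def)

lemma dcomm_trans: "dcomm S T \<Longrightarrow> dcomm T r \<Longrightarrow> dcomm S r"
  by (simp add: dcomm_def)

lemma dcomm_commute: "dcomm T r \<Longrightarrow> T * r = r * T"
  by (simp add: dcomm_def)

lemma dcomm_add: "dcomm T x \<Longrightarrow> dcomm T y \<Longrightarrow> dcomm T (x + y)"
  and dcomm_diff: "dcomm T x \<Longrightarrow> dcomm T y \<Longrightarrow> dcomm T (x - y)"
  and dcomm_uminus: "dcomm T x \<Longrightarrow> dcomm T (- x)"
  and dcomm_1: "dcomm T 1" and dcomm_0: "dcomm T 0"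
  by (simp_all add: dcomm_def algebra_simps)

lemma dcomm_mult: "dcomm T x \<Longrightarrow> dcomm T y \<Longrightarrow> dcomm T (x * y)"
  unfolding dcomm_def by (metis mult.assoc)

lemma dcomm_power: "dcomm T x \<Longrightarrow> dcomm T (x ^ n)"
  by (induction n) (auto intro: dcomm_mult dcomm_1)

lemma dcomm_scaleR: "dcomm T x \<Longrightarrow> dcomm T (r *\<^sub>R x)" for x :: "'a::real_algebra_1"
  by (simp add: dcomm_def)

lemma dcomm_of_real: "dcomm T (of_real r)" for T :: "'a::real_algebra_1"
  by (simp add: dcomm_def of_real_def)

lemmas dcomm_intros = dcomm_self dcomm_add dcomm_diff dcomm_uminus dcomm_1 dcomm_0 dcomm_mult
  dcomm_power dcomm_scaleR dcomm_of_real

lemma dcomm_lim: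
  fixes X :: "nat \<Rightarrow> 'a::real_normed_algebra_1"
  assumes "X \<longlonglongrightarrow> x" "\<And>n. dcomm T (X n)"
  shows "dcomm T x"
  unfolding dcomm_def
proof (intro allI impI)
  fix c assume c: "c * T = T * c"
  have "(\<lambda>n. c * X n) \<longlonglongrightarrow> c * x" "(\<lambda>n. X n * c) \<longlonglongrightarrow> x * c"
    by (intro tendsto_intros assms)+
  moreover have "c * X n = X n * c" for n
    using assms(2) c by (rule dcommD)
  ultimately show "c * x = x * c"
    by (simp add: LIMSEQ_unique)
qed

lemma dcomm_both: "dcomm S a \<Longrightarrow> dcomm T b \<Longrightarrow> S * T = T * S \<Longrightarrow> a * b = b * a"
  unfolding dcomm_def by metis

lemma commute_mult:
  fixes a b x :: "'a::semigroup_mult"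
  assumes "x * a = a * x" "x * b = b * x"
  shows "x * (a * b) = a * b * x"
  by (metis assms mult.assoc)

lemma seq_of_real_shift:
  "(\<lambda>n. T + of_real (inverse (real (Suc n)))) \<longlonglongrightarrow> (T :: 'a::real_normed_algebra_1)"
  using tendsto_add[OF tendsto_const tendsto_of_real[OF LIMSEQ_inverse_real_of_nat], of T] by simp

lemma bounded_linear_emb: "bounded_linear emb"
  by (rule bounded_linear_intro[of _ 1]) (simp_all add: emb_simps)

section \<open>C*-algebras and the norm of their unitization\<close>

locale cstar =
  fixes sc :: "complex \<Rightarrow> 'a::{banach, real_normed_algebra} \<Rightarrow> 'a" and st :: "'a \<Rightarrow> 'a"
  assumes cstar: "cstar_algebra sc st"
begin

lemma
  shows sc_of_real: "sc (complex_of_real r) x = r *\<^sub>R x"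
    and sc_add: "sc a (x + y) = sc a x + sc a y"
    and sc_sc: "sc a (sc b x) = sc (a * b) x"
    and sc_mult_left: "sc a x * y = sc a (x * y)"
    and sc_mult_right: "x * sc a y = sc a (x * y)"
    and st_add: "st (x + y) = st x + st y"
    and st_sc: "st (sc a x) = sc (cnj a) (st x)"
    and st_mult: "st (x * y) = st y * st x"
    and st_st [simp]: "st (st x) = x"
    and norm_st_mult: "norm (st x * x) = (norm x)\<^sup>2"
  using cstar unfolding cstar_algebra_def by metis+

lemma sc_minus_left: "sc (- a) x = - sc a x"
  using sc_sc[of "-1" a x] sc_of_real[of "-1"] by simp

lemma sc_0 [simp]: "sc a 0 = 0"
  using sc_add[of a 0 0] by simp

lemma sc_minus: "sc a (- x) = - sc a x"
  by (metis add_eq_0_iff add.right_inverse sc_0 sc_add)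

lemma sc_diff: "sc a (x - y) = sc a x - sc a y"
  by (metis diff_conv_add_uminus sc_add sc_minus)

lemma sc_1 [simp]: "sc 1 x = x"
  using sc_of_real[of 1] by simp

lemma st_scaleR: "st (r *\<^sub>R x) = r *\<^sub>R st x"
  by (metis sc_of_real st_sc complex_cnj_complex_of_real)

lemma st_0 [simp]: "st 0 = 0"
  using st_scaleR[of 0] by simp

lemma st_minus: "st (- x) = - st x"
  using st_scaleR[of "-1"] by simp

lemma st_diff: "st (x - y) = st x - st y"
  by (metis diff_conv_add_uminus st_add st_minus)

lemma st_sum: "st (sum f A) = (\<Sum>x\<in>A. st (f x))"
  by (induction A rule: infinite_finite_induct) (simp_all add: st_add)

lemma norm_st [simp]: "norm (st x) = norm x"
proof -
  have le: "norm x \<le> norm (st x)" for x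
  proof (cases "norm x = 0")
    case False
    have "norm x * norm x \<le> norm (st x) * norm x"
      using norm_mult_ineq[of "st x" x] by (simp add: norm_st_mult power2_eq_square)
    then show ?thesis
      using False by (simp add: mult_le_cancel_right)
  qed simp
  show ?thesis
    using le[of x] le[of "st x"] by simp
qed

lemma st_mult_self_eq_0: "st x * x = 0 \<longleftrightarrow> x = 0"
  using norm_st_mult[of x] by auto

lemma real_imag_parts:
  obtains a b where "st a = a" "st b = b" "x = a + sc \<i> b"
proof
  define a where "a = (1/2) *\<^sub>R (x + st x)"
  define b where "b = sc \<i> ((1/2) *\<^sub>R (st x - x))"
  show "st a = a"
    by (simp add: a_def st_scaleR st_add add.commute)
  show "st b = b"
    by (simp add: b_def st_scaleR st_diff st_sc sc_minus_left flip: sc_minus scaleR_minus_right)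
  have "sc \<i> b = (1/2) *\<^sub>R (x - st x)"
    by (simp add: b_def sc_sc sc_minus_left algebra_simps)
  then show "x = a + sc \<i> b"
    by (simp add: a_def flip: scaleR_add_right)
qed

section \<open>Involution and C*-norm bounds on the unitization\<close>

definition adj :: "'a unitization \<Rightarrow> 'a unitization"
  where "adj T = Unz (scl T) (st (elt T))"

lemma scl_adj [simp]: "scl (adj T) = scl T" and elt_adj [simp]: "elt (adj T) = st (elt T)"
  by (simp_all add: adj_def)

lemma adj_emb: "adj (emb x) = emb (st x)"
  by (simp add: unitization_eq_iff)

lemma adj_simps:
  "adj (S + T) = adj S + adj T" "adj (S - T) = adj S - adj T" "adj (- T) = - adj T"
  "adj (r *\<^sub>R T) = r *\<^sub>R adj T" "adj (S * T) = adj T * adj S" "adj (adj T) = T"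
  "adj 0 = 0" "adj 1 = 1" "adj (of_real r) = of_real r"
  by (simp_all add: unitization_eq_iff elt_mult st_add st_diff st_minus st_scaleR st_mult)

lemma norm_adj [simp]: "norm (adj T) = norm T"
  by (simp add: norm_unitization)

lemma adj_lim:
  assumes "X \<longlonglongrightarrow> x" "\<And>n. adj (X n) = X n"
  shows "adj x = x"
proof -
  have "bounded_linear adj"
    by (rule bounded_linear_intro[of _ 1]) (simp_all add: adj_simps)
  then have "(\<lambda>n. adj (X n)) \<longlonglongrightarrow> adj x"
    using assms(1) by (rule bounded_linear.tendsto)
  then show ?thesis
    using assms by (simp add: LIMSEQ_unique)
qed

text \<open>\<^term>\<open>bnd T K\<close> says that \<^term>\<open>T\<close> has norm at most \<^term>\<open>K\<close> in the C*-norm of the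
  unitization, that is, in the direct sum of the scalars and the left regular representation.
  The norm of the type \<^typ>\<open>'a unitization\<close> is only equivalent to it.\<close>

definition bnd :: "'a unitization \<Rightarrow> real \<Rightarrow> bool"
  where "bnd T K \<longleftrightarrow> \<bar>scl T\<bar> \<le> K \<and> (\<forall>y. norm (T * emb y) \<le> K * norm y)"

lemma bndD: "bnd T K \<Longrightarrow> norm (T * emb y) \<le> K * norm y"
  by (simp add: bnd_def)

lemma bnd_scl: "bnd T K \<Longrightarrow> \<bar>scl T\<bar> \<le> K"
  by (simp add: bnd_def)

lemma bnd_nonneg: "bnd T K \<Longrightarrow> 0 \<le> K"
  by (auto simp: bnd_def)

lemma bnd_mono: "bnd T K \<Longrightarrow> K \<le> L \<Longrightarrow> bnd T L"
  unfolding bnd_def by (meson mult_right_mono norm_ge_zero order_trans)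

lemma bnd_norm: "bnd T (norm T)"
proof -
  have "norm (T * emb y) \<le> norm T * norm y" for y
    using norm_mult_ineq[of T "emb y"] by simp
  then show ?thesis
    by (simp add: bnd_def norm_unitization)
qed

lemma bnd_add: "bnd S K \<Longrightarrow> bnd T L \<Longrightarrow> bnd (S + T) (K + L)"
  unfolding bnd_def
  by (auto simp: distrib_right intro!: order_trans[OF norm_triangle_ineq] add_mono
      order_trans[OF abs_triangle_ineq])

lemma bnd_scaleR: "bnd T K \<Longrightarrow> bnd (r *\<^sub>R T) (\<bar>r\<bar> * K)"
  unfolding bnd_def by (auto simp: abs_mult mult.assoc intro: mult_left_mono)

lemma bnd_uminus: "bnd T K \<Longrightarrow> bnd (- T) K"
  using bnd_scaleR[of T K "-1"] by simp

lemma bnd_diff: "bnd S K \<Longrightarrow> bnd T L \<Longrightarrow> bnd (S - T) (K + L)"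
  using bnd_add[of S K "- T" L] bnd_uminus by simp

lemma bnd_mult:
  assumes "bnd S K" "bnd T L"
  shows "bnd (S * T) (K * L)"
proof -
  have "norm (S * T * emb y) \<le> K * L * norm y" for y
  proof -
    have "S * T * emb y = S * emb (elt (T * emb y))"
      by (simp add: emb_elt mult.assoc)
    also have "norm \<dots> \<le> K * norm (T * emb y)"
      using bndD[OF assms(1), of "elt (T * emb y)"] by (simp add: norm_unitization)
    also have "\<dots> \<le> K * (L * norm y)"
      using bndD[OF assms(2)] bnd_nonneg[OF assms(1)] by (simp add: mult_left_mono)
    finally show ?thesis
      by (simp add: mult.assoc)
  qed
  moreover have "\<bar>scl (S * T)\<bar> \<le> K * L"
    using assms by (auto simp: abs_mult intro: mult_mono dest: bnd_scl bnd_nonneg)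
  ultimately show ?thesis
    by (simp add: bnd_def)
qed

lemma bnd_of_real: "bnd (of_real r) \<bar>r\<bar>"
  by (simp add: bnd_def of_real_def)

lemma bnd_lim:
  assumes "X \<longlonglongrightarrow> x" "k \<longlonglongrightarrow> K" "\<And>n::nat. bnd (X n) (k n)"
  shows "bnd x K"
proof -
  have "norm (x * emb y) \<le> K * norm y" for y
  proof (rule LIMSEQ_le)
    show "(\<lambda>n. norm (X n * emb y)) \<longlonglongrightarrow> norm (x * emb y)"
      by (intro tendsto_intros assms)
    show "(\<lambda>n. k n * norm y) \<longlonglongrightarrow> K * norm y"
      by (intro tendsto_intros assms)
  qed (use assms(3) in \<open>auto dest: bndD\<close>)
  moreover have "\<bar>scl x\<bar> \<le> K"
  proof (rule LIMSEQ_le)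
    show "(\<lambda>n. \<bar>scl (X n)\<bar>) \<longlonglongrightarrow> \<bar>scl x\<bar>"
      by (intro tendsto_intros bounded_linear.tendsto[OF bounded_linear_scl] assms)
  qed (use assms in \<open>auto dest: bnd_scl\<close>)
  ultimately show ?thesis
    by (simp add: bnd_def)
qed

text \<open>Testing on \<open>y = st x\<close>, the C*-identity recovers \<open>norm x\<close>, so
  on the algebra itself \<open>bnd\<close> bounds exactly the given norm.\<close>

lemma bnd_emb: "bnd (emb x) K \<longleftrightarrow> norm x \<le> K"
proof
  assume *: "bnd (emb x) K"
  have "norm x * norm x \<le> K * norm x"
    using bndD[OF *, of "st x"] norm_st_mult[of "st x"]
    by (simp add: power2_eq_square flip: emb_simps)
  then show "norm x \<le> K"
    by (cases "norm x = 0") (use bnd_nonneg[OF *] in \<open>auto simp: mult_le_cancel_right\<close>)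
next
  assume "norm x \<le> K"
  then show "bnd (emb x) K"
    using bnd_norm[of "emb x"] by (auto intro: bnd_mono)
qed

text \<open>The scalar part contributes at most \<open>K\<close>, and the algebra part, being
  \<open>T\<close> minus its scalar part, at most \<open>K + K\<close>. This transfers convergence
  from C*-bounds to the norm of the type.\<close>

lemma norm_le_of_bnd:
  assumes "bnd T K"
  shows "norm T \<le> 3 * K"
proof -
  have "emb (elt T) = T - of_real (scl T)"
    by (simp add: unitization_eq_iff)
  then have "bnd (emb (elt T)) (K + \<bar>scl T\<bar>)"
    using bnd_diff[OF assms bnd_of_real[of "scl T"]] by simp
  then show ?thesis
    using bnd_scl[OF assms] by (simp add: bnd_emb norm_unitization)
qed

lemma bnd_0D: "bnd T 0 \<Longrightarrow> T = 0"
  using norm_le_of_bnd[of T 0] by simp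

text \<open>The C*-inequality for the unitization: the square of the norm of \<open>T y\<close> is
  the norm of \<open>y* (T* T) y\<close>.\<close>

lemma bnd_adj_mult:
  assumes "bnd (adj T * T) (K\<^sup>2)" "0 \<le> K"
  shows "bnd T K"
proof -
  have "norm (T * emb y) \<le> K * norm y" for y
  proof (rule power2_le_imp_le)
    define X where "X = elt (T * emb y)"
    have X: "emb X = T * emb y"
      by (simp add: X_def emb_elt)
    have "emb (st X * X) = adj (emb X) * emb X"
      by (simp add: emb_simps adj_emb)
    also have "\<dots> = emb (st y) * emb (elt ((adj T * T) * emb y))"
      unfolding X by (simp add: adj_simps adj_emb emb_elt mult.assoc)
    finally have "norm (st X * X) = norm (emb (st y) * emb (elt ((adj T * T) * emb y)))"
      by (metis norm_emb)
    also have "\<dots> \<le> norm y * norm ((adj T * T) * emb y)"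
      using norm_mult_ineq[of "emb (st y)" "emb (elt ((adj T * T) * emb y))"]
      by (simp add: emb_elt)
    also have "\<dots> \<le> norm y * (K\<^sup>2 * norm y)"
      using bndD[OF assms(1)] by (simp add: mult_left_mono)
    finally show "(norm (T * emb y))\<^sup>2 \<le> (K * norm y)\<^sup>2"
      using X[symmetric] by (simp add: norm_st_mult power2_eq_square mult_ac)
  qed (use assms in simp)
  moreover have "\<bar>scl T\<bar> \<le> K"
    using bnd_scl[OF assms(1)] assms(2) abs_le_square_iff[of "scl T" K]
    by (simp add: power2_eq_square)
  ultimately show ?thesis
    by (simp add: bnd_def)
qed

text \<open>By the assumption the two cross terms, with factors \<open>\<i>\<close> and
  \<open>- \<i>\<close>, cancel.\<close>

lemma norm_add_sc_i:
  assumes "st a * b = st b * a"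
  shows "(norm (a + sc \<i> b))\<^sup>2 = norm (st a * a + st b * b)"
proof -
  have "st (a + sc \<i> b) * (a + sc \<i> b) = st a * a + st b * b"
    using assms
    by (simp add: st_add st_sc algebra_simps sc_mult_left sc_mult_right sc_sc sc_minus_left sc_diff)
  then show ?thesis
    by (metis norm_st_mult)
qed

text \<open>The element \<open>h + \<i> r\<close> is a multiple of a unitary; \<open>h\<close> is its real part.\<close>

lemma bnd_sqrt_of_squares:
  assumes h: "adj h = h" and r: "adj r = r" and hr: "h * r = r * h"
    and c: "h * h + r * r = of_real c"
  shows "bnd h (sqrt c)"
proof -
  have sclc: "(scl h)\<^sup>2 + (scl r)\<^sup>2 = c"
    using arg_cong[OF c, of scl] by (simp add: power2_eq_square)
  then have c0: "0 \<le> c"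
    by (metis sum_power2_ge_zero)
  have "norm (h * emb y) \<le> sqrt c * norm y" for y
  proof -
    define a b where "a = elt (h * emb y)" and "b = elt (r * emb y)"
    have a: "emb a = h * emb y" and b: "emb b = r * emb y"
      by (simp_all add: a_def b_def emb_elt)
    have "emb (st a * b) = emb (st y) * (h * r) * emb y"
      "emb (st b * a) = emb (st y) * (r * h) * emb y"
      by (simp_all add: emb_simps a b adj_simps h r mult.assoc flip: adj_emb)
    then have ab: "st a * b = st b * a"
      by (metis hr emb_eq_iff)
    have "emb (st a * a + st b * b) = emb (st y) * (h * h + r * r) * emb y"
      by (simp add: emb_simps a b adj_simps h r algebra_simps flip: adj_emb)
    also have "\<dots> = emb (c *\<^sub>R (st y * y))"
      by (simp add: c of_real_def emb_simps)
    finally have eq: "st a * a + st b * b = c *\<^sub>R (st y * y)"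
      by simp
    have *: "norm (a + sc \<i> b') \<le> sqrt c * norm y" if "b' = b \<or> b' = - b" for b'
    proof (rule power2_le_imp_le)
      have "st a * b' = st b' * a" "st b' * b' = st b * b"
        using that ab by (auto simp: st_minus)
      then show "(norm (a + sc \<i> b'))\<^sup>2 \<le> (sqrt c * norm y)\<^sup>2"
        using c0 by (simp add: norm_add_sc_i eq power_mult_distrib norm_st_mult)
    qed (use c0 in simp)
    \<comment> \<open>\<open>a\<close> is the mean of the images of \<open>y\<close> under h + i r
      and h - i r, each of norm at most \<open>sqrt c * norm y\<close>.\<close>
    have "2 *\<^sub>R a = (a + sc \<i> b) + (a + sc \<i> (- b))"
      by (simp add: sc_minus scaleR_2)
    then have "2 * norm a \<le> norm (a + sc \<i> b) + norm (a + sc \<i> (- b))"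
      by (metis norm_scaleR norm_triangle_ineq abs_numeral)
    then have "norm a \<le> sqrt c * norm y"
      using *[of b] *[of "- b"] by simp
    then show ?thesis
      by (metis a norm_emb)
  qed
  moreover have "\<bar>scl h\<bar> \<le> sqrt c"
    using sclc by (metis real_sqrt_le_mono real_sqrt_abs le_add_same_cancel1 zero_le_power2)
  ultimately show ?thesis
    by (simp add: bnd_def)
qed

text \<open>The square root of \<open>T = 1 - W\<close> is \<open>1 - g\<close>, where \<open>g\<close> is the fixed point of the contraction
  \<open>g \<mapsto> (W + g\<^sup>2) / 2\<close>.\<close>

lemma sqrt_near_one:
  assumes T: "adj T = T" and rho: "bnd (1 - T) \<rho>" "\<rho> < 1"
  obtains r where "adj r = r" "r * r = T" "dcomm T r" "bnd (1 - r) \<rho>"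
proof -
  define W where "W = 1 - T"
  have W: "adj W = W" "bnd W \<rho>"
    using T rho by (simp_all add: W_def adj_simps)
  have rho0: "0 \<le> \<rho>"
    using bnd_nonneg rho(1) by blast
  define g where "g = rec_nat 0 (\<lambda>_ x. (1/2) *\<^sub>R (W + x * x))"
  have g0: "g 0 = 0" and gS: "g (Suc n) = (1/2) *\<^sub>R (W + g n * g n)" for n
    by (simp_all add: g_def)
  have g_adj: "adj (g n) = g n" for n
    by (induction n) (simp_all add: g0 gS adj_simps W)
  have g_comm: "dcomm W (g n)" for n
    by (induction n) (auto simp: g0 gS intro: dcomm_intros)
  have g_bnd: "bnd (g n) \<rho>" for n
  proof (induction n)
    case 0
    then show ?case using bnd_norm[of 0] rho0 by (auto simp: g0 intro: bnd_mono)
  next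
    case (Suc n)
    have "bnd (g (Suc n)) (\<bar>1/2\<bar> * (\<rho> + \<rho> * \<rho>))"
      unfolding gS by (intro bnd_scaleR bnd_add bnd_mult W Suc)
    moreover have "\<rho> * \<rho> \<le> \<rho>"
      using rho0 rho(2) by (simp add: mult_left_le)
    ultimately show ?case
      by (auto intro: bnd_mono)
  qed
  have diff: "bnd (g (Suc n) - g n) (\<rho> ^ n)" for n
  proof (induction n)
    case 0
    show ?case
      using bnd_scaleR[OF W(2), of "1/2"] rho by (auto simp: g0 gS intro: bnd_mono)
  next
    case (Suc n)
    \<comment> \<open>The contraction factor is \<rho>: a difference of squares splits off the sum
      of two iterates, bounded by \<open>\<rho> + \<rho>\<close>, and the factor 1/2 halves
      this.\<close>
    have com: "g (Suc n) * g n = g n * g (Suc n)"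
      using dcomm_both[OF g_comm g_comm] by blast
    have "g (Suc (Suc n)) - g (Suc n)
        = (1/2) *\<^sub>R (g (Suc n) * g (Suc n) - g n * g n)"
      by (simp only: gS[of "Suc n"] gS[of n] flip: scaleR_diff_right) simp
    also have "\<dots> = (1/2) *\<^sub>R ((g (Suc n) - g n) * (g (Suc n) + g n))"
      using com by (simp add: algebra_simps)
    finally have "bnd (g (Suc (Suc n)) - g (Suc n)) (\<bar>1/2\<bar> * (\<rho> ^ n * (\<rho> + \<rho>)))"
      using bnd_scaleR[OF bnd_mult[OF Suc bnd_add[OF g_bnd g_bnd]], of "1/2"] by simp
    then show ?case
      by (simp add: mult.commute)
  qed
  have "summable (\<lambda>n. g (Suc n) - g n)"
  proof (rule summable_comparison_test')
    show "summable (\<lambda>n. 3 * \<rho> ^ n)"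
      using rho0 rho(2) by (intro summable_mult summable_geometric) simp
  qed (use norm_le_of_bnd[OF diff] in auto)
  then have "convergent (\<lambda>n. \<Sum>i<n. g (Suc i) - g i)"
    by (simp add: summable_iff_convergent)
  then obtain G where G: "g \<longlonglongrightarrow> G"
    by (auto simp: sum_lessThan_telescope g0 convergent_def)
  have "(\<lambda>n. g (Suc n)) \<longlonglongrightarrow> (1/2) *\<^sub>R (W + G * G)"
    unfolding gS by (intro tendsto_intros G)
  then have "G = (1/2) *\<^sub>R (W + G * G)"
    using G LIMSEQ_Suc LIMSEQ_unique by blast
  then have "2 *\<^sub>R G = 2 *\<^sub>R ((1/2) *\<^sub>R (W + G * G))"
    by (rule arg_cong)
  then have "2 *\<^sub>R G = W + G * G"
    by simp
  then have sq: "(1 - G) * (1 - G) = T"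
    by (simp add: W_def algebra_simps scaleR_2)
  show thesis
  proof
    show "adj (1 - G) = 1 - G"
      using adj_lim[OF G] g_adj by (simp add: adj_simps)
    have "dcomm T W"
      unfolding W_def by (intro dcomm_intros)
    then show "dcomm T (1 - G)"
      by (intro dcomm_intros dcomm_trans[OF _ dcomm_lim[OF G g_comm]])
    show "bnd (1 - (1 - G)) \<rho>"
      using bnd_lim[OF G tendsto_const g_bnd] by simp
  qed (rule sq)
qed

section \<open>Positive elements\<close>

text \<open>In spectral terms the spectrum lies in [0, 2t]. Additivity is then just the triangle
  inequality; limits and products have to wait for square roots.\<close>

definition Pos :: "'a unitization \<Rightarrow> bool"
  where "Pos T \<longleftrightarrow> adj T = T \<and> (\<exists>t. bnd (of_real t - T) t)"

lemma PosI: "adj T = T \<Longrightarrow> bnd (of_real t - T) t \<Longrightarrow> Pos T"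
  by (auto simp: Pos_def)

lemma Pos_adj: "Pos T \<Longrightarrow> adj T = T"
  by (simp add: Pos_def)

lemma adj_mult_self_eq_0: "adj T * T = 0 \<Longrightarrow> T = 0"
  using bnd_adj_mult[of T 0] bnd_norm[of 0] by (auto intro: bnd_0D)

lemma Pos_add: "Pos S \<Longrightarrow> Pos T \<Longrightarrow> Pos (S + T)"
proof -
  assume "Pos S" "Pos T"
  then obtain s t where "bnd (of_real s - S) s" "bnd (of_real t - T) t" "adj S = S" "adj T = T"
    by (auto simp: Pos_def)
  then have "bnd (of_real (s + t) - (S + T)) (s + t)" "adj (S + T) = S + T"
    using bnd_add[of "of_real s - S" s "of_real t - T" t] by (simp_all add: algebra_simps adj_simps)
  then show "Pos (S + T)"
    by (rule PosI[rotated])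
qed

lemma Pos_scaleR: "Pos T \<Longrightarrow> 0 \<le> r \<Longrightarrow> Pos (r *\<^sub>R T)"
proof -
  assume "Pos T" "0 \<le> r"
  then obtain t where "bnd (of_real t - T) t" "adj T = T"
    by (auto simp: Pos_def)
  then have "bnd (of_real (r * t) - r *\<^sub>R T) (r * t)"
    using bnd_scaleR[of "of_real t - T" t r] \<open>0 \<le> r\<close>
    by (simp add: of_real_def scaleR_diff_right)
  then show "Pos (r *\<^sub>R T)"
    using \<open>adj T = T\<close> by (intro PosI[of _ "r * t"]) (simp_all add: adj_simps)
qed

lemma Pos_of_bnd_1: "adj T = T \<Longrightarrow> bnd (1 - T) 1 \<Longrightarrow> Pos T"
  unfolding Pos_def by (intro conjI exI[of _ 1]) auto

lemma Pos_diff_of_bnd: "adj T = T \<Longrightarrow> bnd T t \<Longrightarrow> Pos (of_real t - T)"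
  unfolding Pos_def by (intro conjI exI[of _ t]) (auto simp: adj_simps)

lemma Pos_0: "Pos 0"
  unfolding Pos_def using bnd_norm[of 0] by (intro conjI exI[of _ 0]) (auto simp: adj_simps)

lemma Pos_1: "Pos 1"
  using bnd_norm[of 0] by (intro Pos_of_bnd_1) (auto simp: adj_simps intro: bnd_mono)

section \<open>Squares, square roots and products of positive elements\<close>

text \<open>Since \<open>c' < c\<close>, the element \<open>T = 1 - h * h / c\<close> has a square
  root \<open>r\<close>. The squares of \<open>r\<close> and \<open>h / sqrt c\<close> add up to 1,
  so \<open>r\<close>, and with it \<open>T\<close>, is bounded by 1.\<close>

lemma bnd_diff_square:
  assumes h: "adj h = h" and b: "bnd (h * h) c'" and c: "c' < c"
  shows "bnd (of_real c - h * h) c"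
proof -
  have c0: "0 < c"
    using bnd_nonneg[OF b] c by simp
  define T where "T = 1 - (1 / c) *\<^sub>R (h * h)"
  have adjT: "adj T = T"
    by (simp add: T_def adj_simps h)
  have "bnd (1 - T) (c' / c)"
    using bnd_scaleR[OF b, of "1 / c"] c0 by (simp add: T_def)
  then obtain r where r: "adj r = r" "r * r = T" "dcomm T r"
    using sqrt_near_one[OF adjT] c c0 by (metis divide_less_eq_1_pos)
  have hT: "h * T = T * h"
    by (simp add: T_def algebra_simps)
  define k where "k = (1 / sqrt c) *\<^sub>R h"
  have "bnd r (sqrt 1)"
  proof (rule bnd_sqrt_of_squares)
    show "adj r = r" "adj k = k"
      by (simp_all add: r k_def adj_simps h)
    show "r * k = k * r"
      using dcommD[OF r(3) hT] by (simp add: k_def)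
    show "r * r + k * k = of_real 1"
      using c0 by (simp add: r T_def k_def)
  qed
  then have "bnd T 1"
    using bnd_mult[of r 1 r 1] r by simp
  moreover have "of_real c - h * h = c *\<^sub>R T"
    using c0 by (simp add: T_def scaleR_diff_right of_real_def)
  ultimately show ?thesis
    using bnd_scaleR[of T 1 c] c0 by simp
qed

lemma Pos_square: "adj h = h \<Longrightarrow> Pos (h * h)"
  using bnd_diff_square[OF _ bnd_norm, of h "norm (h * h) + 1"]
  by (intro PosI[of _ "norm (h * h) + 1"]) (simp_all add: adj_simps)

text \<open>Divided by \<open>S = t + \<epsilon>\<close>, the shifted element is within
  \<open>t / S < 1\<close> of the unit, where \<open>sqrt_near_one\<close> applies.\<close>

lemma Pos_approx_sqrt:
  assumes T: "Pos T" and e: "0 < \<epsilon>"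
  obtains r where "Pos r" "r * r = T + of_real \<epsilon>" "dcomm T r"
proof -
  obtain t where t: "bnd (of_real t - T) t"
    using T by (auto simp: Pos_def)
  define S where "S = t + \<epsilon>"
  have S: "0 < S" "t / S < 1"
    using bnd_nonneg[OF t] e by (simp_all add: S_def)
  define T' where "T' = (1 / S) *\<^sub>R (T + of_real \<epsilon>)"
  have adjT': "adj T' = T'"
    by (simp add: T'_def adj_simps Pos_adj T)
  have "1 = (1 / S) *\<^sub>R (of_real S :: 'a unitization)"
    using S by (simp add: of_real_def)
  then have "1 - T' = (1 / S) *\<^sub>R (of_real S - (T + of_real \<epsilon>))"
    unfolding T'_def by (metis scaleR_diff_right)
  also have "of_real S - (T + of_real \<epsilon>) = of_real t - T"
    by (simp add: S_def)
  finally have "bnd (1 - T') (t / S)"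
    using bnd_scaleR[OF t, of "1 / S"] S by simp
  then obtain r where r: "adj r = r" "r * r = T'" "dcomm T' r" "bnd (1 - r) (t / S)"
    using sqrt_near_one[OF adjT'] S by metis
  have "Pos r"
    using bnd_mono[OF r(4), of 1] S by (intro Pos_of_bnd_1 r) simp
  moreover have "dcomm T T'"
    unfolding T'_def by (intro dcomm_intros)
  ultimately show thesis
    using S by (intro that[of "sqrt S *\<^sub>R r"] dcomm_scaleR dcomm_trans[OF _ r(3)])
      (simp_all add: r(2) T'_def Pos_scaleR)
qed

text \<open>Every bound \<open>K\<close> of \<open>T\<close> can serve as the \<open>t\<close> in
  \<open>Pos\<close>. A convergent sequence has a common bound, which is why \<open>Pos_lim\<close>
  follows. The proof writes \<open>T + \<epsilon>\<close> as a square, bounded by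
  \<open>K + \<epsilon>\<close>, and leaves a second \<epsilon> for the strict inequality in
  \<open>bnd_diff_square\<close>.\<close>

lemma bnd_diff_Pos:
  assumes T: "Pos T" and K: "bnd T K"
  shows "bnd (of_real K - T) K"
proof (rule bnd_lim)
  let ?e = "\<lambda>n. inverse (real (Suc n))"
  show "(\<lambda>n. (of_real K - T) + of_real (?e n)) \<longlonglongrightarrow> of_real K - T"
    by (rule seq_of_real_shift)
  show "(\<lambda>n. K + (?e n + ?e n)) \<longlonglongrightarrow> K"
    using tendsto_add[OF tendsto_const[of K] tendsto_add[OF LIMSEQ_inverse_real_of_nat
          LIMSEQ_inverse_real_of_nat]] by simp
  fix n
  obtain r where r: "Pos r" "r * r = T + of_real (?e n)"
    using Pos_approx_sqrt[OF T, of "?e n"] by auto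
  have "bnd (r * r) (K + ?e n)"
    unfolding r using bnd_add[OF K bnd_of_real[of "?e n"]] by simp
  then have "bnd (of_real (K + (?e n + ?e n)) - r * r) (K + (?e n + ?e n))"
    by (intro bnd_diff_square[OF Pos_adj[OF r(1)]]) auto
  moreover have "of_real (K + (\<epsilon> + \<epsilon>)) - (T + of_real \<epsilon>) = (of_real K - T) + of_real \<epsilon>" for \<epsilon>
    by (simp only: of_real_add add.assoc[symmetric] add_diff_cancel_right diff_add_eq)
  ultimately show "bnd ((of_real K - T) + of_real (?e n)) (K + (?e n + ?e n))"
    by (simp only: r)
qed

lemma Pos_lim:
  assumes X: "X \<longlonglongrightarrow> x" and P: "\<And>n. Pos (X n)"
  shows "Pos x"
proof -
  have "convergent X"
    using X by (auto simp: convergent_def)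
  then obtain K where K: "\<And>n. norm (X n) \<le> K"
    using convergent_imp_Bseq BseqE by metis
  have "bnd (of_real K - X n) K" for n
    by (intro bnd_diff_Pos P bnd_mono[OF bnd_norm K])
  moreover have "(\<lambda>n. of_real K - X n) \<longlonglongrightarrow> of_real K - x"
    by (intro tendsto_intros X)
  ultimately have "bnd (of_real K - x) K"
    using bnd_lim tendsto_const by blast
  moreover have "adj x = x"
    using adj_lim[OF X] P Pos_adj by blast
  ultimately show ?thesis
    by (rule PosI[rotated])
qed

text \<open>Approximate roots of commuting elements commute, so the product of the shifted factors
  is the square of the self-adjoint \<open>r * k\<close>.\<close>

lemma Pos_mult:
  assumes S: "Pos S" and T: "Pos T" and ST: "S * T = T * S"
  shows "Pos (S * T)"
proof (rule Pos_lim)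
  let ?e = "\<lambda>n. inverse (real (Suc n))"
  show "(\<lambda>n. (S + of_real (?e n)) * (T + of_real (?e n))) \<longlonglongrightarrow> S * T"
    by (intro tendsto_mult seq_of_real_shift)
  fix n
  obtain r where r: "Pos r" "r * r = S + of_real (?e n)" "dcomm S r"
    using Pos_approx_sqrt[OF S, of "?e n"] by auto
  obtain k where k: "Pos k" "k * k = T + of_real (?e n)" "dcomm T k"
    using Pos_approx_sqrt[OF T, of "?e n"] by auto
  have rk: "r * k = k * r"
    by (rule dcomm_both[OF r(3) k(3) ST])
  then have "(r * r) * (k * k) = (r * k) * (r * k)"
    by (metis mult.assoc)
  moreover have "adj (r * k) = r * k"
    by (simp add: adj_simps Pos_adj r k rk)
  ultimately show "Pos ((S + of_real (?e n)) * (T + of_real (?e n)))"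
    using Pos_square[of "r * k"] by (simp add: r k)
qed

text \<open>With \<open>r\<close> a root of \<open>t\<^sup>2 - x * x + \<epsilon>\<close>, the
  squares of \<open>x\<close> and \<open>r\<close> add up to the scalar
  \<open>t\<^sup>2 + \<epsilon>\<close>, and \<open>bnd_sqrt_of_squares\<close> applies.\<close>

lemma bnd_of_Pos_square:
  assumes x: "adj x = x" and t: "0 \<le> t" and P: "Pos (of_real (t\<^sup>2) - x * x)"
  shows "bnd x t"
proof (rule bnd_lim)
  let ?e = "\<lambda>n. inverse (real (Suc n))"
  show "(\<lambda>n. x) \<longlonglongrightarrow> x"
    by simp
  have "(\<lambda>n. sqrt (t\<^sup>2 + ?e n)) \<longlonglongrightarrow> sqrt (t\<^sup>2 + 0)"
    by (intro tendsto_intros LIMSEQ_inverse_real_of_nat)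
  then show "(\<lambda>n. sqrt (t\<^sup>2 + ?e n)) \<longlonglongrightarrow> t"
    using t by simp
  fix n
  obtain r where r: "Pos r" "r * r = of_real (t\<^sup>2) - x * x + of_real (?e n)"
    "dcomm (of_real (t\<^sup>2) - x * x) r"
    using Pos_approx_sqrt[OF P, of "?e n"] by auto
  have "x * (of_real (t\<^sup>2) - x * x) = (of_real (t\<^sup>2) - x * x) * x"
    by (simp add: algebra_simps of_real_def)
  then have "x * r = r * x"
    by (rule dcommD[OF r(3)])
  then show "bnd x (sqrt (t\<^sup>2 + ?e n))"
    by (intro bnd_sqrt_of_squares[OF x Pos_adj[OF r(1)]]) (simp_all only: r, simp)
qed

text \<open>The decomposition \<open>t\<^sup>2 - x * x = (t - x)\<^sup>2 + 2 x (t - x)\<close> has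
  positive summands.\<close>

lemma bnd_of_Pos:
  assumes x: "Pos x" and tx: "Pos (of_real t - x)"
  shows "bnd x t"
proof (rule bnd_of_Pos_square)
  show "adj x = x"
    by (rule Pos_adj[OF x])
  have "Pos (of_real t)"
    using Pos_add[OF x tx] by simp
  then obtain s where "bnd (of_real s - of_real t) s"
    by (auto simp: Pos_def)
  then show "0 \<le> t"
    using bnd_scl by fastforce
  have com: "x * (of_real t - x) = (of_real t - x) * x"
    by (simp add: algebra_simps of_real_def)
  have "of_real (t\<^sup>2) - x * x
      = (of_real t - x) * (of_real t - x) + 2 *\<^sub>R (x * (of_real t - x))"
    by (simp add: algebra_simps of_real_def power2_eq_square scaleR_2)
      (simp flip: scaleR_2)
  moreover have "Pos ((of_real t - x) * (of_real t - x) + 2 *\<^sub>R (x * (of_real t - x)))"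
    by (intro Pos_add Pos_scaleR Pos_mult x tx com) simp_all
  ultimately show "Pos (of_real (t\<^sup>2) - x * x)"
    by simp
qed

lemma Pos_antisym:
  assumes "Pos x" "Pos (- x)"
  shows "x = 0"
  using bnd_of_Pos[of x 0] assms by (auto intro: bnd_0D)

text \<open>The roots \<open>r n\<close> of \<open>T + 1 / (n + 1)\<close> form a Cauchy sequence,
  because the C*-norm of \<open>r m - r n\<close> is at most the square root of the difference of
  the shifts.\<close>

lemma Pos_sqrt:
  assumes T: "Pos T"
  obtains r where "Pos r" "r * r = T" "dcomm T r"
proof -
  let ?e = "\<lambda>n. inverse (real (Suc n))"
  have "\<exists>r. Pos r \<and> r * r = T + of_real (?e n) \<and> dcomm T r" for n
    using Pos_approx_sqrt[OF T, of "?e n"] by (metis inverse_positive_iff_positive of_nat_0_less_iff zero_less_Suc)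
  then obtain r where r: "\<And>n. Pos (r n)" "\<And>n. r n * r n = T + of_real (?e n)"
    "\<And>n. dcomm T (r n)"
    by metis
  have diff: "bnd (r m - r n) (sqrt \<bar>?e m - ?e n\<bar>)" for m n
  proof -
    define \<eta> where "\<eta> = ?e m - ?e n"
    define D where "D = r m - r n"
    define E where "E = r m + r n"
    have com: "r m * r n = r n * r m"
      by (rule dcomm_both[OF r(3) r(3)]) simp
    have DE: "D * E = of_real \<eta>" "E * D = of_real \<eta>"
      using com by (simp_all add: D_def E_def \<eta>_def algebra_simps r(2))
    have adjD: "adj D = D"
      by (simp add: D_def adj_simps Pos_adj r)
    \<comment> \<open>From \<open>D * E = \<eta>\<close> one gets \<open>\<eta>\<^sup>2 - D\<^sup>4
      = D\<^sup>2 (E\<^sup>2 - D\<^sup>2) = 4 D\<^sup>2 (r m) (r n)\<close>, a product of commuting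
      positive elements; hence \<open>D\<^sup>2\<close> is bounded by the absolute value of
      \<eta>.\<close>
    have "D * D * (E * E) = D * (D * E) * E"
      by (simp add: mult.assoc)
    also have "\<dots> = \<eta> *\<^sub>R (D * E)"
      by (simp only: DE(1) of_real_def) (simp add: DE(1) of_real_def)
    also have "\<dots> = of_real (\<eta>\<^sup>2)"
      by (simp only: DE(1)) (simp add: of_real_def power2_eq_square)
    finally have "D * D * (E * E) = of_real (\<eta>\<^sup>2)" .
    moreover have "E * E - D * D = (r m * r n + r m * r n) + (r m * r n + r m * r n)"
      using com by (simp add: D_def E_def algebra_simps)
    then have EED: "E * E - D * D = 4 *\<^sub>R (r m * r n)"
      by (simp flip: scaleR_2)
    ultimately have "of_real (\<eta>\<^sup>2) - (D * D) * (D * D) = (D * D) * (4 *\<^sub>R (r m * r n))"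
      by (metis right_diff_distrib)
    moreover have "D * D * (r m * r n) = (r m * r n) * (D * D)"
    proof -
      have "D * r k = r k * D" if "k = m \<or> k = n" for k
        using com that by (auto simp: D_def algebra_simps)
      then have "D * (r m * r n) = (r m * r n) * D"
        by (intro commute_mult) simp_all
      from commute_mult[OF this[symmetric] this[symmetric]] show ?thesis
        by (rule sym)
    qed
    then have "Pos ((D * D) * (4 *\<^sub>R (r m * r n)))"
      by (intro Pos_mult Pos_square adjD Pos_scaleR r com) simp_all
    ultimately have "Pos (of_real (\<bar>\<eta>\<bar>\<^sup>2) - (D * D) * (D * D))"
      by (simp only: power2_abs)
    then have "bnd (D * D) \<bar>\<eta>\<bar>"
      by (rule bnd_of_Pos_square[rotated 2]) (simp_all add: adj_simps adjD)
    then have "bnd D (sqrt \<bar>\<eta>\<bar>)"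
      using bnd_adj_mult[of D "sqrt \<bar>\<eta>\<bar>"] by (simp add: adjD)
    then show ?thesis
      by (simp only: D_def \<eta>_def)
  qed
  have "Cauchy r"
    unfolding Cauchy_iff
  proof (intro allI impI)
    fix e :: real
    assume e: "0 < e"
    have "Cauchy ?e"
      using LIMSEQ_inverse_real_of_nat LIMSEQ_imp_Cauchy by blast
    then obtain M where M: "\<And>m n. m \<ge> M \<Longrightarrow> n \<ge> M \<Longrightarrow> norm (?e m - ?e n) < (e / 3)\<^sup>2"
      using e unfolding Cauchy_iff by (meson zero_less_power divide_pos_pos zero_less_numeral)
    have "norm (r m - r n) < e" if "m \<ge> M" "n \<ge> M" for m n
    proof -
      have "sqrt \<bar>?e m - ?e n\<bar> < e / 3"
        using M[OF that] e by (intro real_less_lsqrt) simp_all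
      then show ?thesis
        using norm_le_of_bnd[OF diff[of m n]] by simp
    qed
    then show "\<exists>M. \<forall>m\<ge>M. \<forall>n\<ge>M. norm (r m - r n) < e"
      by blast
  qed
  then obtain R where R: "r \<longlonglongrightarrow> R"
    using Cauchy_convergent convergent_def by blast
  have "(\<lambda>n. r n * r n) \<longlonglongrightarrow> R * R"
    by (intro tendsto_intros R)
  then have "R * R = T"
    unfolding r(2) using seq_of_real_shift LIMSEQ_unique by blast
  then show thesis
    using that Pos_lim[OF R] dcomm_lim[OF R] r by blast
qed

text \<open>With \<open>s\<close> the positive square root of \<open>p\<^sup>2\<close> and \<open>n = s - p\<close> one finds \<open>s n\<^sup>3 = n\<^sup>4 / 2\<close>
  and \<open>n\<^sup>3 = - 2 r n\<^sup>2\<close>, so that both \<open>n\<^sup>4\<close> and \<open>- n\<^sup>4\<close> are positive.\<close>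

lemma Pos_of_mult_eq_square:
  assumes r: "Pos r" and p: "adj p = p" and rp: "r * p = p * p" "p * r = p * p"
  shows "Pos p"
proof -
  obtain s where s: "Pos s" "s * s = p * p" "dcomm (p * p) s"
    using Pos_sqrt[OF Pos_square[OF p]] by blast
  have ps: "p * s = s * p"
    by (rule dcommD[OF s(3)]) (simp add: mult.assoc)
  have rs: "r * s = s * r"
    by (rule dcommD[OF s(3)]) (metis rp mult.assoc)
  define n where "n = s - p"
  have n_adj: "adj n = n"
    by (simp add: n_def adj_simps Pos_adj[OF s(1)] p)
  have s_eq: "s = p + n"
    by (simp add: n_def)
  have pn: "p * n = n * p" and rn: "r * n = n * r"
    using ps rs rp by (simp_all add: n_def algebra_simps)
  have nn: "n * n = - 2 *\<^sub>R (p * n)"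
    using s(2) ps by (simp add: n_def algebra_simps scaleR_2)
  have rnn: "n * n * n = - 2 *\<^sub>R (r * (n * n))"
  proof -
    have "r * (n * n) = - 2 *\<^sub>R (r * p * n)"
      by (simp add: nn mult.assoc)
    also have "\<dots> = p * (- 2 *\<^sub>R (p * n))"
      by (simp add: rp mult.assoc)
    also have "\<dots> = p * n * n"
      by (simp only: nn[symmetric] mult.assoc)
    finally have "- 2 *\<^sub>R (r * (n * n)) = (- 2 *\<^sub>R (p * n)) * n"
      by simp
    then show ?thesis
      by (simp only: nn)
  qed
  have "s * (n * n * n) = p * n * n * n + n * n * n * n"
    by (simp add: s_eq algebra_simps)
  moreover have "p * n * n * n = (- 1 / 2) *\<^sub>R (n * n * n * n)"
  proof -
    have "p * n = (- 1 / 2) *\<^sub>R (n * n)"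
      by (simp add: nn)
    then show ?thesis
      by simp
  qed
  ultimately have "s * (n * n * n) = (- 1 / 2 + 1) *\<^sub>R (n * n * n * n)"
    by (simp only: scaleR_add_left scaleR_one)
  then have sn: "s * (n * n * n) = (1 / 2) *\<^sub>R (n * n * (n * n))"
    by (simp add: mult.assoc)
  have "Pos (r * (n * n))"
    by (intro Pos_mult r Pos_square n_adj commute_mult rn)
  then have "Pos (- (n * n * n))"
    using Pos_scaleR[of "r * (n * n)" 2] by (simp add: rnn)
  moreover have sn': "s * n = n * s"
    using ps by (simp add: n_def algebra_simps)
  have "s * (- (n * n * n)) = - (n * n * n) * s"
    using commute_mult[OF commute_mult[OF sn' sn'] sn'] by simp
  ultimately have "Pos (s * (- (n * n * n)))"
    using s by (intro Pos_mult)
  then have "Pos (- (n * n * (n * n)))"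
    using Pos_scaleR[of "s * (- (n * n * n))" 2] sn by simp
  moreover have "Pos (n * n * (n * n))"
    by (intro Pos_square) (simp add: adj_simps n_adj)
  ultimately have "n * n * (n * n) = 0"
    by (intro Pos_antisym)
  then have "n * n = 0"
    using adj_mult_self_eq_0[of "n * n"] by (simp add: adj_simps n_adj)
  then have "n = 0"
    using adj_mult_self_eq_0[of n] by (simp add: n_adj)
  then show ?thesis
    using s s_eq by simp
qed

text \<open>Here \<open>r\<close> is the absolute value of \<open>h\<close>. From
  \<open>r * r = h * h\<close> it follows that \<open>r * p = p * p\<close> and
  \<open>r * m = m * m\<close>, which is the situation of
  \<open>Pos_of_mult_eq_square\<close>.\<close>

lemma pos_neg_parts:
  assumes h: "adj h = h"
  obtains p m where "Pos p" "Pos m" "h = p - m" "p * m = 0" "m * p = 0" "dcomm h p" "dcomm h m"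
proof -
  obtain r where r: "Pos r" "r * r = h * h" "dcomm (h * h) r"
    using Pos_sqrt[OF Pos_square[OF h]] by blast
  have hr: "h * r = r * h"
    by (rule dcommD[OF r(3)]) (simp add: mult.assoc)
  define p where "p = (1/2) *\<^sub>R (r + h)"
  define m where "m = (1/2) *\<^sub>R (r - h)"
  have "dcomm h (h * h)"
    by (intro dcomm_intros)
  then have hr': "dcomm h r"
    using r(3) by (rule dcomm_trans)
  have adj: "adj p = p" "adj m = m"
    by (simp_all add: p_def m_def adj_simps Pos_adj[OF r(1)] h)
  have "2 *\<^sub>R (p * p) = 2 *\<^sub>R (r * p)" "2 *\<^sub>R (p * p) = 2 *\<^sub>R (p * r)"
       "2 *\<^sub>R (m * m) = 2 *\<^sub>R (r * m)" "2 *\<^sub>R (m * m) = 2 *\<^sub>R (m * r)"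
    using hr r(2) by (simp_all add: p_def m_def algebra_simps flip: scaleR_2)
  then have eqs: "r * p = p * p" "p * r = p * p" "r * m = m * m" "m * r = m * m"
    by simp_all
  show thesis
  proof
    show "Pos p" "Pos m"
      using Pos_of_mult_eq_square[OF r(1)] adj eqs by auto
    show "h = p - m"
      by (simp add: p_def m_def algebra_simps flip: scaleR_add_left)
    show "p * m = 0" "m * p = 0"
      using hr r(2) by (simp_all add: p_def m_def algebra_simps)
    show "dcomm h p" "dcomm h m"
      unfolding p_def m_def by (intro dcomm_intros hr')+
  qed
qed

section \<open>Positivity of \<open>z\<^sup>* z\<close>\<close>

lemma square_square_eq_0:
  assumes "adj m = m" "m * m * (m * m) = 0"
  shows "m = 0"
proof -
  have "m * m = 0"
    using adj_mult_self_eq_0[of "m * m"] assms by (simp add: adj_simps)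
  then show ?thesis
    using adj_mult_self_eq_0[of m] assms by simp
qed

text \<open>If \<open>w\<^sup>* w = - c\<close> with \<open>c\<close> and \<open>b = w w\<^sup>*\<close> positive, then \<open>(t - b) w = w (t + c)\<close> has norm
  at most \<open>t \<parallel>w\<parallel>\<close>, which bounds \<open>c (t + c)\<^sup>2\<close> by \<open>t\<^sup>2 \<parallel>c\<parallel>\<close>.\<close>

lemma eq_0_of_neg_star_mult:
  assumes c: "Pos c" "emb (st w * w) = - c" and b: "Pos (emb (w * st w))"
  shows "c = 0"
proof -
  define \<kappa> where "\<kappa> = norm c"
  define B where "B = emb (w * st w)"
  define W where "W = emb w"
  define t where "t = norm B + 1"
  have t: "0 < t"
    by (simp add: t_def add_nonneg_pos)
  have scl_c: "scl c = 0"
    using arg_cong[OF c(2), of scl] by simp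
  have adjc: "adj c = c"
    by (rule Pos_adj[OF c(1)])
  have \<kappa>: "(norm w)\<^sup>2 = \<kappa>"
    using norm_st_mult[of w] arg_cong[OF c(2), of norm] by (simp add: \<kappa>_def)
  have WW: "adj W * W = - c" and BW: "B * W = - (W * c)"
    using c(2) by (simp_all add: W_def B_def adj_emb mult.assoc flip: emb_simps)
      (simp add: emb_simps flip: mult_minus_right)
  have "bnd (of_real t - B) t"
    using b bnd_norm[of B] by (intro bnd_diff_Pos) (auto simp: B_def t_def intro: bnd_mono)
  moreover have "bnd W (norm w)"
    by (simp add: W_def bnd_emb)
  moreover have "(of_real t - B) * W = W * (of_real t + c)"
    by (simp add: BW algebra_simps of_real_def)
  ultimately have X: "bnd (W * (of_real t + c)) (t * norm w)"
    by (metis bnd_mult)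
  define x where "x = elt (W * (of_real t + c))"
  have x: "emb x = W * (of_real t + c)"
    by (simp add: x_def emb_elt W_def)
  have "norm x \<le> t * norm w"
    using X by (simp add: bnd_emb flip: x)
  then have "norm (st x * x) \<le> t\<^sup>2 * \<kappa>"
    unfolding norm_st_mult \<kappa>[symmetric] power_mult_distrib[symmetric] by (simp add: power_mono)
  then have "bnd (emb (st x * x)) (t\<^sup>2 * \<kappa>)"
    by (simp add: bnd_emb)
  moreover have "emb (st x * x) = - (c * ((of_real t + c) * (of_real t + c)))"
  proof -
    have "emb (st x * x) = (of_real t + c) * (adj W * W) * (of_real t + c)"
      by (simp add: emb_simps x adj_simps adjc mult.assoc flip: adj_emb)
    also have "\<dots> = - (c * ((of_real t + c) * (of_real t + c)))"
      by (simp add: WW algebra_simps of_real_def)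
    finally show ?thesis .
  qed
  ultimately have "bnd (c * ((of_real t + c) * (of_real t + c))) (t\<^sup>2 * \<kappa>)"
    using bnd_uminus by fastforce
  moreover have "adj (c * ((of_real t + c) * (of_real t + c))) = c * ((of_real t + c) * (of_real t + c))"
    by (simp add: adj_simps adjc) (simp add: algebra_simps of_real_def)
  ultimately have P: "Pos (of_real (t\<^sup>2 * \<kappa>) - c * ((of_real t + c) * (of_real t + c)))"
    by (intro Pos_diff_of_bnd)
  \<comment> \<open>The added positive terms cancel the powers of \<open>c\<close> above the first,
    so \<open>Q\<close> is affine in \<open>c\<close>. As \<open>c\<close> has norm \<kappa>, the
    resulting bound reduces to \<open>t * \<kappa>\<^sup>2 \<le> 0\<close>.\<close>
  define Q where "Q = (of_real (t\<^sup>2 * \<kappa>) - c * ((of_real t + c) * (of_real t + c))) + c * (c * c)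
      + (t + t) *\<^sub>R ((c - of_real \<kappa>) * (c - of_real \<kappa>))"
  have "Pos Q"
    unfolding Q_def using t
    by (intro Pos_add P Pos_scaleR Pos_mult c Pos_square) (simp_all add: adj_simps adjc mult.assoc)
  moreover have two: "(t * 2) *\<^sub>R X = t *\<^sub>R X + t *\<^sub>R X"
    "(\<kappa> * (t * 4)) *\<^sub>R X = (\<kappa> * (t * 2)) *\<^sub>R X + (\<kappa> * (t * 2)) *\<^sub>R X" for X :: "'a unitization"
    by (simp_all flip: scaleR_add_left)
  have "Q = (t\<^sup>2 * \<kappa> + (t + t) * \<kappa>\<^sup>2) *\<^sub>R 1 - (t\<^sup>2 + (t + t) * (\<kappa> + \<kappa>)) *\<^sub>R c"
    by (simp add: Q_def of_real_def power2_eq_square algebra_simps)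
      (simp only: two add.assoc)
  ultimately have "Pos (of_real (t\<^sup>2 * \<kappa> + (t + t) * \<kappa>\<^sup>2) - (t\<^sup>2 + (t + t) * (\<kappa> + \<kappa>)) *\<^sub>R c)"
    by (simp add: of_real_def)
  then have "bnd ((t\<^sup>2 + (t + t) * (\<kappa> + \<kappa>)) *\<^sub>R c) (t\<^sup>2 * \<kappa> + (t + t) * \<kappa>\<^sup>2)"
    using t by (intro bnd_of_Pos Pos_scaleR c) (simp_all add: \<kappa>_def)
  moreover have "emb (elt ((t\<^sup>2 + (t + t) * (\<kappa> + \<kappa>)) *\<^sub>R c))
      = (t\<^sup>2 + (t + t) * (\<kappa> + \<kappa>)) *\<^sub>R c"
    by (rule emb_elt) (simp add: scl_c)
  ultimately have "bnd (emb (elt ((t\<^sup>2 + (t + t) * (\<kappa> + \<kappa>)) *\<^sub>R c))) (t\<^sup>2 * \<kappa> + (t + t) * \<kappa>\<^sup>2)"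
    by (simp only:)
  then have "(t\<^sup>2 + (t + t) * (\<kappa> + \<kappa>)) * \<kappa> \<le> t\<^sup>2 * \<kappa> + (t + t) * \<kappa>\<^sup>2"
    unfolding bnd_emb using t by (simp add: \<kappa>_def norm_unitization scl_c)
  then have "t * \<kappa>\<^sup>2 \<le> 0"
    by (simp add: algebra_simps power2_eq_square)
  then have "\<kappa> = 0"
    using t by (simp add: mult_le_0_iff)
  then show ?thesis
    by (simp add: \<kappa>_def)
qed

text \<open>Kaplansky's argument: for \<open>w = z m\<close> with \<open>m\<close> the negative part
  of \<open>z* z\<close>, the element \<open>w* w = - m\<^sup>3\<close> is negative. But
  \<open>w w* + w* w = 2 (a\<^sup>2 + b\<^sup>2)\<close> for the real and imaginary parts of
  \<open>w\<close>, so \<open>w w*\<close> is positive, and \<open>eq_0_of_neg_star_mult\<close>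
  forces \<open>m = 0\<close>.\<close>

lemma Pos_star_mult: "Pos (emb (st z * z))"
proof -
  define h where "h = emb (st z * z)"
  have "adj h = h"
    by (simp add: h_def adj_emb st_mult)
  then obtain p m where pm: "Pos p" "Pos m" "h = p - m" "p * m = 0" "m * p = 0"
    using pos_neg_parts by blast
  have "scl m = 0"
    using arg_cong[OF pm(3), of scl] arg_cong[OF pm(4), of scl] by (simp add: h_def)
  then have m: "emb (elt m) = m"
    by (rule emb_elt)
  define w where "w = z * elt m"
  define c where "c = m * (m * m)"
  have c: "Pos c"
    unfolding c_def by (intro Pos_mult Pos_square pm Pos_adj) (simp add: mult.assoc)
  have "emb (st w) = m * emb (st z)"
    using m by (simp add: w_def st_mult emb_simps flip: adj_emb) (simp add: adj_simps adj_emb Pos_adj pm)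
  then have "emb (st w * w) = m * h * m"
    using m by (simp add: emb_simps h_def w_def mult.assoc)
  then have ww: "emb (st w * w) = - c"
    using pm by (simp add: algebra_simps c_def)
  obtain a b where ab: "st a = a" "st b = b" "w = a + sc \<i> b"
    using real_imag_parts by blast
  have "w * st w = 2 *\<^sub>R (a * a + b * b) - st w * w"
    unfolding ab(3)
    by (simp add: ab st_add st_sc sc_minus_left sc_mult_left sc_mult_right sc_sc sc_add sc_diff
        algebra_simps scaleR_2)
  then have "emb (w * st w) = 2 *\<^sub>R (emb a * emb a + emb b * emb b) + c"
    using ww by (simp add: emb_simps)
  moreover have "Pos (2 *\<^sub>R (emb a * emb a + emb b * emb b) + c)"
    by (intro Pos_add Pos_scaleR Pos_square c) (simp_all add: adj_emb ab)
  ultimately have "c = 0"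
    using eq_0_of_neg_star_mult[OF c ww] by simp
  then have "m * m * (m * m) = 0"
    by (simp add: c_def mult.assoc)
  then have "m = 0"
    by (rule square_square_eq_0[OF Pos_adj[OF pm(2)]])
  then show ?thesis
    using pm h_def by simp
qed

text \<open>The bridge to the order of the theorem. The root of an embedded element has scalar part
  0, hence comes from the algebra.\<close>

lemma positive_iff: "positive st a \<longleftrightarrow> Pos (emb a)"
proof
  assume "Pos (emb a)"
  then obtain r where r: "Pos r" "r * r = emb a"
    using Pos_sqrt by blast
  have "scl r = 0"
    using arg_cong[OF r(2), of scl] by simp
  then have "emb a = emb (elt r * elt r)"
    using r by (simp add: emb_simps emb_elt)
  moreover have "st (elt r) = elt r"
    using Pos_adj[OF r(1)] by (metis elt_adj)
  ultimately show "positive st a"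
    unfolding positive_def by (metis emb_eq_iff)
qed (auto simp: positive_def Pos_star_mult)

section \<open>The order in terms of \<open>Pos\<close>, and powers of contractions\<close>

lemma cstar_le_iff: "cstar_le st x y \<longleftrightarrow> Pos (emb y - emb x)"
  by (simp add: cstar_le_def positive_iff emb_simps)

lemma Pos_proj: "p * p = p \<Longrightarrow> st p = p \<Longrightarrow> Pos (emb p)"
  using Pos_star_mult[of p] by simp

lemma Pos_1_diff_proj:
  assumes "p * p = p" "st p = p"
  shows "Pos (1 - emb p)"
proof -
  have "emb p * emb p = emb p"
    using assms by (simp flip: emb_simps)
  then show ?thesis
    using Pos_square[of "1 - emb p"] assms by (simp add: adj_simps adj_emb algebra_simps)
qed

lemma Pos_power: "Pos T \<Longrightarrow> Pos (T ^ n)"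
  by (induction n) (auto intro: Pos_1 Pos_mult simp: power_commutes)

lemma bnd_mult_power:
  assumes b: "Pos b" "Pos (1 - b)" and n: "0 < n"
  shows "bnd (b * (1 - b) ^ n) (1 / real n)"
proof -
  define d where "d = 1 - b"
  have bd: "b = 1 - d"
    by (simp add: d_def)
  have d: "Pos d"
    using b by (simp add: d_def)
  have comd: "b * d ^ k = d ^ k * b" for k
    by (simp add: bd algebra_simps power_commutes)
  have P: "Pos (b * d ^ k)" for k
    by (intro Pos_mult Pos_power d b comd)
  \<comment> \<open>\<open>1 - d ^ k\<close> is the sum of the \<open>k\<close> elements
    \<open>b * d ^ i\<close> with \<open>i < k\<close>, and these decrease to at least
    \<open>b * d ^ k\<close>.\<close>
  have X: "Pos (1 - d ^ k - real k *\<^sub>R (b * d ^ k))" for k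
  proof (induction k)
    case (Suc k)
    have "1 - d ^ Suc k - real (Suc k) *\<^sub>R (b * d ^ Suc k)
        = (1 - d ^ k - real k *\<^sub>R (b * d ^ k)) + real (Suc k) *\<^sub>R (b * (b * d ^ k))"
      by (simp add: bd algebra_simps)
    moreover have "Pos (b * (b * d ^ k))"
      by (rule Pos_mult[OF b(1) P commute_mult[OF refl comd]])
    ultimately show ?case
      using Suc by (metis Pos_add Pos_scaleR of_nat_0_le_iff)
  qed (simp add: Pos_0)
  have "Pos (of_real 1 - real n *\<^sub>R (b * d ^ n))"
    using Pos_add[OF X[of n] Pos_power[OF d, of n]] by simp
  then have "bnd (real n *\<^sub>R (b * d ^ n)) 1"
    using P by (intro bnd_of_Pos Pos_scaleR) simp_all
  then show ?thesis
    using bnd_scaleR[of "real n *\<^sub>R (b * d ^ n)" 1 "1 / real n"] n by (simp add: d_def)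
qed

section \<open>Maximal abelian subalgebras\<close>

text \<open>Zorn's lemma, started at the bicommutant of \<open>S\<close>, which is an abelian star
  subalgebra because \<open>S\<close> is abelian and closed under \<open>st\<close>.\<close>

lemma ex_masa:
  assumes S: "\<And>x. x \<in> S \<Longrightarrow> st x \<in> S" "abelian S"
  obtains M where "masa sc st M" "S \<subseteq> M"
proof -
  define C where "C = (\<lambda>X :: 'a set. {x. \<forall>y\<in>X. x * y = y * x})"
  define \<A> where "\<A> = {N. star_subalg sc st N \<and> abelian N \<and> S \<subseteq> N}"
  have CD: "x * y = y * x" if "x \<in> C X" "y \<in> X" for x y X
    using that by (simp add: C_def)
  have C_star: "st x \<in> C X" if "x \<in> C X" "\<And>y. y \<in> X \<Longrightarrow> st y \<in> X" for x X
  proof -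
    have "st x * y = y * st x" if "y \<in> X" for y
    proof -
      have "st (x * st y) = st (st y * x)"
        using \<open>x \<in> C X\<close> \<open>\<And>y. y \<in> X \<Longrightarrow> st y \<in> X\<close>[OF that] by (simp add: C_def)
      then show ?thesis
        by (simp add: st_mult)
    qed
    then show ?thesis
      by (simp add: C_def)
  qed
  have C_alg: "star_subalg sc st (C X)" if "\<And>y. y \<in> X \<Longrightarrow> st y \<in> X" for X
  proof -
    have "x * y * z = z * (x * y)" if "x \<in> C X" "y \<in> C X" "z \<in> X" for x y z
      using that by (intro commute_mult[symmetric]) (simp_all add: C_def)
    then show ?thesis
      using C_star[OF _ that] unfolding star_subalg_def
      by (auto simp: C_def algebra_simps sc_mult_left sc_mult_right)
  qed
  \<comment> \<open>Commutants reverse inclusions, so \<open>C (C S)\<close> lies in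
    \<open>C S\<close> and therefore commutes with itself.\<close>
  have "S \<subseteq> C S"
    using S(2) by (auto simp: C_def abelian_def)
  then have "x \<in> C S" if "x \<in> C (C S)" for x
    using that by (auto simp: C_def)
  then have "abelian (C (C S))"
    using CD unfolding abelian_def by blast
  moreover have "S \<subseteq> C (C S)"
    by (auto simp: C_def)
  ultimately have "C (C S) \<in> \<A>"
    using C_alg C_star S by (simp add: \<A>_def)
  moreover have "\<Union>\<C> \<in> \<A>" if ne: "\<C> \<noteq> {}" and ch: "subset.chain \<A> \<C>" for \<C>
  proof -
    have mem: "N \<in> \<A>" if "N \<in> \<C>" for N
      using ch that by (auto simp: subset_chain_def)
    have two: "\<exists>N\<in>\<C>. x \<in> N \<and> y \<in> N" if "x \<in> \<Union>\<C>" "y \<in> \<Union>\<C>" for x y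
    proof -
      obtain N N' where N: "N \<in> \<C>" "x \<in> N" "N' \<in> \<C>" "y \<in> N'"
        using \<open>x \<in> \<Union>\<C>\<close> \<open>y \<in> \<Union>\<C>\<close> by blast
      then have "N \<subseteq> N' \<or> N' \<subseteq> N"
        using ch by (simp add: subset_chain_def)
      then show ?thesis
        using N by blast
    qed
    have ops: "0 \<in> N" "S \<subseteq> N" "\<And>c x. x \<in> N \<Longrightarrow> sc c x \<in> N" "\<And>x. x \<in> N \<Longrightarrow> st x \<in> N"
      "\<And>x y. x \<in> N \<Longrightarrow> y \<in> N \<Longrightarrow> x + y \<in> N \<and> x * y \<in> N \<and> x * y = y * x" if "N \<in> \<C>" for N
      using mem[OF that] by (simp_all add: \<A>_def abelian_def star_subalg_def)
    have "x * y = y * x \<and> x + y \<in> \<Union>\<C> \<and> x * y \<in> \<Union>\<C>"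
      if "x \<in> \<Union>\<C>" "y \<in> \<Union>\<C>" for x y
      using two[OF that] ops(5) by (meson UnionI)
    moreover have "sc c x \<in> \<Union>\<C> \<and> st x \<in> \<Union>\<C>" if "x \<in> \<Union>\<C>" for c x
      using that ops(3,4) by blast
    moreover have "S \<subseteq> \<Union>\<C> \<and> 0 \<in> \<Union>\<C>"
      using ne ops(1,2) by blast
    ultimately show ?thesis
      by (simp add: \<A>_def star_subalg_def abelian_def)
  qed
  ultimately obtain M where M: "M \<in> \<A>" "\<And>X. X \<in> \<A> \<Longrightarrow> M \<subseteq> X \<Longrightarrow> X = M"
    using subset_Zorn_nonempty[of \<A>] by blast
  then have "masa sc st M" "S \<subseteq> M"
    unfolding masa_def \<A>_def by blast+
  then show thesis
    by (rule that)
qed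

context
  fixes M
  assumes M: "masa sc st M"
begin

lemma
  shows masa_0: "0 \<in> M"
    and masa_add: "x \<in> M \<Longrightarrow> y \<in> M \<Longrightarrow> x + y \<in> M"
    and masa_mult: "x \<in> M \<Longrightarrow> y \<in> M \<Longrightarrow> x * y \<in> M"
    and masa_sc: "x \<in> M \<Longrightarrow> sc c x \<in> M"
    and masa_st: "x \<in> M \<Longrightarrow> st x \<in> M"
    and masa_commute: "x \<in> M \<Longrightarrow> y \<in> M \<Longrightarrow> x * y = y * x"
  using M by (auto simp: masa_def star_subalg_def abelian_def)

lemma masa_scaleR: "x \<in> M \<Longrightarrow> r *\<^sub>R x \<in> M"
  using masa_sc[of x "complex_of_real r"] by (simp add: sc_of_real)

lemma masa_diff: "x \<in> M \<Longrightarrow> y \<in> M \<Longrightarrow> x - y \<in> M"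
  using masa_add[of x "(-1) *\<^sub>R y"] masa_scaleR[of y "-1"] by simp

lemma masa_sum: "(\<And>i. i \<in> A \<Longrightarrow> f i \<in> M) \<Longrightarrow> sum f A \<in> M"
  by (induction A rule: infinite_finite_induct) (auto intro: masa_0 masa_add)

lemma masa_emb_commute: "x \<in> M \<Longrightarrow> y \<in> M \<Longrightarrow> emb x * emb y = emb y * emb x"
  by (simp add: masa_commute flip: emb_simps)

text \<open>A self-adjoint \<open>a\<close> commuting with \<open>M\<close> lies with
  \<open>M\<close> in a maximal abelian subalgebra, which must be \<open>M\<close>. A general
  \<open>x\<close> need not commute with \<open>st x\<close>, so its real and imaginary parts are
  treated separately.\<close>

lemma masa_commutant:
  assumes x: "\<And>y. y \<in> M \<Longrightarrow> x * y = y * x"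
  shows "x \<in> M"
proof -
  have sa: "a \<in> M" if "st a = a" and a: "\<And>y. y \<in> M \<Longrightarrow> a * y = y * a" for a
  proof -
    have "abelian (insert a M)"
      using a by (auto simp: abelian_def masa_commute)
    moreover have "st x \<in> insert a M" if "x \<in> insert a M" for x
      using that \<open>st a = a\<close> masa_st by auto
    ultimately obtain N where "masa sc st N" "insert a M \<subseteq> N"
      using ex_masa by blast
    then show ?thesis
      using M unfolding masa_def by blast
  qed
  obtain a b where ab: "st a = a" "st b = b" "x = a + sc \<i> b"
    using real_imag_parts by blast
  have st_x: "st x * y = y * st x" if "y \<in> M" for y
    using x[OF masa_st[OF that]] by (metis st_mult st_st)
  have a: "a = (1/2) *\<^sub>R (x + st x)"
    by (simp add: ab st_add st_sc sc_minus_left flip: scaleR_2)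
  have a': "a * y = y * a" if "y \<in> M" for y
    using x[OF that] st_x[OF that] by (simp add: a algebra_simps)
  have b: "b = sc (- \<i>) (x - a)"
    by (simp add: ab sc_sc)
  have "b * y = y * b" if "y \<in> M" for y
    using x[OF that] a'[OF that] by (simp add: b sc_mult_left sc_mult_right algebra_simps)
  then show ?thesis
    using sa[of a] sa[of b] ab a' by (simp add: masa_add masa_sc)
qed

text \<open>Keeps positive and negative parts, and the approximate unit of a support projection,
  inside \<open>M\<close>.\<close>

lemma masa_dcomm:
  assumes "x \<in> M" "dcomm (emb x) r" "scl r = 0"
  shows "elt r \<in> M"
proof (rule masa_commutant)
  fix y assume "y \<in> M"
  then have "emb y * r = r * emb y"
    by (intro dcommD[OF assms(2)] masa_emb_commute assms)
  then have "emb (elt r * y) = emb (y * elt r)"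
    using assms(3) by (simp add: emb_simps emb_elt)
  then show "elt r * y = y * elt r"
    by simp
qed

lemma masa_closed: "closed M"
proof -
  have "M = (\<Inter>y\<in>M. {x. x * y = y * x})"
    using masa_commutant masa_commute by blast
  moreover have "closed (\<Inter>y\<in>M. {x. x * y = y * x})"
    by (intro closed_INT ballI closed_Collect_eq continuous_intros)
  ultimately show ?thesis
    by simp
qed

end

lemma Pos_emb_st: "Pos (emb x) \<Longrightarrow> st x = x"
  using Pos_adj[of "emb x"] by (simp add: adj_emb)

section \<open>Projections in monotone complete maximal abelian subalgebras\<close>

lemma Pos_1_diff_scaleR:
  assumes "Pos T"
  shows "Pos (1 - (1 / (norm T + 1)) *\<^sub>R T)"
proof -
  have "bnd ((1 / (norm T + 1)) *\<^sub>R T) (\<bar>1 / (norm T + 1)\<bar> * norm T)"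
    by (intro bnd_scaleR bnd_norm)
  then have "bnd ((1 / (norm T + 1)) *\<^sub>R T) 1"
    by (rule bnd_mono) (simp add: divide_simps add_nonneg_pos)
  then show ?thesis
    using Pos_diff_of_bnd[of "(1 / (norm T + 1)) *\<^sub>R T" 1] assms by (simp add: adj_simps Pos_adj)
qed

text \<open>A supremum \<open>e\<close> of an approximate unit \<open>D\<close> satisfies \<open>e u \<ge> u\<close> for \<open>u \<in> D\<close>, so
  \<open>f = e - c e (e - 1)\<^sup>2\<close> is an upper bound of \<open>D\<close> for small \<open>c > 0\<close>.\<close>

lemma sup_projection:
  assumes M: "masa sc st M" and mc: "monotone_complete st M"
    and D: "D \<subseteq> M" "D \<noteq> {}"
    and dir: "\<And>x y. x \<in> D \<Longrightarrow> y \<in> D \<Longrightarrow> \<exists>z\<in>D. Pos (emb z - emb x) \<and> Pos (emb z - emb y)"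
    and Pos_D: "\<And>x. x \<in> D \<Longrightarrow> Pos (emb x)" and D_le_1: "\<And>x. x \<in> D \<Longrightarrow> Pos (1 - emb x)"
    and approx: "\<And>u. u \<in> D \<Longrightarrow> \<exists>v. (\<forall>n::nat. v n \<in> D) \<and> (\<lambda>n. v n * u) \<longlonglongrightarrow> u"
  obtains e where "e \<in> M" "e * e = e" "st e = e" "\<And>u. u \<in> D \<Longrightarrow> e * u = u"
    "\<And>q. q \<in> M \<Longrightarrow> Pos (emb q) \<Longrightarrow> (\<And>u. u \<in> D \<Longrightarrow> u * q = 0) \<Longrightarrow> e * q = 0"
proof -
  have "D \<subseteq> sa_part st M"
    using D Pos_D by (auto simp: sa_part_def intro: Pos_emb_st)
  moreover have "bounded D"
    unfolding bounded_iff using bnd_of_Pos[of _ 1] Pos_D D_le_1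
    by (intro exI[of _ 1]) (simp flip: bnd_emb)
  moreover have "directed_up (cstar_le st) D"
    using dir D by (simp add: directed_up_def cstar_le_iff)
  ultimately obtain e where "is_sup_in (cstar_le st) (sa_part st M) D e"
    using mc unfolding monotone_complete_def by blast
  then have e: "e \<in> M" "st e = e" and up: "\<And>u. u \<in> D \<Longrightarrow> Pos (emb e - emb u)"
    and least: "\<And>v. v \<in> M \<Longrightarrow> st v = v \<Longrightarrow> (\<And>u. u \<in> D \<Longrightarrow> Pos (emb v - emb u)) \<Longrightarrow> Pos (emb v - emb e)"
    by (auto simp: is_sup_in_def sa_part_def cstar_le_iff)
  define E where "E = emb e"
  have adjE: "adj E = E"
    by (simp add: E_def adj_emb e)
  obtain u0 where "u0 \<in> D"
    using D by blast
  then have PE: "Pos E"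
    using Pos_add[OF up Pos_D, of u0 u0] by (simp add: E_def)
  have com: "E * emb x = emb x * E" if "x \<in> M" for x
    unfolding E_def by (rule masa_emb_commute[OF M e(1) that])
  \<comment> \<open>\<open>v n \<le> e\<close> gives \<open>v n * u \<le> e * u\<close>; the limit
    in \<open>n\<close> yields \<open>u \<le> e * u\<close>.\<close>
  have EU: "Pos (E * emb u - emb u)" if u: "u \<in> D" for u
  proof -
    obtain v where v: "\<And>n::nat. v n \<in> D" "(\<lambda>n. v n * u) \<longlonglongrightarrow> u"
      using approx[OF u] by blast
    have "(\<lambda>n. E * emb u - emb (v n * u)) \<longlonglongrightarrow> E * emb u - emb u"
      by (intro tendsto_intros bounded_linear.tendsto[OF bounded_linear_emb] v)
    moreover have "Pos (E * emb u - emb (v n * u))" for n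
    proof -
      have "Pos ((E - emb (v n)) * emb u)"
        using com[of u] masa_emb_commute[OF M, of "v n" u] D u v(1)[of n]
        by (intro Pos_mult Pos_D u) (simp_all add: E_def up algebra_simps subset_eq)
      then show ?thesis
        by (simp add: algebra_simps emb_simps)
    qed
    ultimately show ?thesis
      by (rule Pos_lim)
  qed
  define k where "k = norm e"
  \<comment> \<open>Both \<open>(E - 1)\<^sup>2\<close> and \<open>E * (E - 1)\<close> have norm at
    most \<open>(k + 1)\<^sup>2\<close>, so their multiples by \<open>c\<close> stay below
    1.\<close>
  define c where "c = 1 / (k + 1)\<^sup>2"
  have k: "0 \<le> k" and c: "0 < c" "c * (k + 1)\<^sup>2 = 1"
    by (simp_all add: c_def k_def add_nonneg_eq_0_iff add_nonneg_pos)
  have "norm (E - 1) \<le> k + 1" "norm E = k"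
    using norm_triangle_ineq4[of E 1] by (simp_all add: E_def k_def)
  then have n1: "norm ((E - 1) * (E - 1)) \<le> (k + 1)\<^sup>2" "norm (E * (E - 1)) \<le> (k + 1)\<^sup>2"
    unfolding power2_eq_square using k
    by (auto intro!: order_trans[OF norm_mult_ineq] mult_mono)
  have le1: "Pos (1 - c *\<^sub>R T)" if "norm T \<le> (k + 1)\<^sup>2" "adj T = T" for T
  proof -
    have "bnd (c *\<^sub>R T) (\<bar>c\<bar> * (k + 1)\<^sup>2)"
      by (intro bnd_scaleR bnd_mono[OF bnd_norm that(1)])
    then show ?thesis
      using Pos_diff_of_bnd[of "c *\<^sub>R T" 1] c that(2) by (simp add: adj_simps)
  qed
  define G where "G = (E - 1) * (E - 1)"
  define H where "H = 1 - c *\<^sub>R (E * (E - 1))"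
  define f where "f = E - c *\<^sub>R (E * G)"
  have PG: "Pos G"
    unfolding G_def by (intro Pos_square) (simp add: adj_simps adjE)
  have EG: "E * G = G * E"
    by (simp add: G_def algebra_simps)
  have PEG: "Pos (E * G)"
    by (intro Pos_mult PE PG EG)
  have "Pos (1 - c *\<^sub>R G)"
    using n1 by (intro le1 Pos_adj PG) (simp add: G_def)
  then have "Pos (E * (1 - c *\<^sub>R G))"
    using EG by (intro Pos_mult PE) (simp_all add: algebra_simps)
  then have Pf: "Pos f"
    by (simp add: f_def algebra_simps)
  have PH: "Pos H"
    unfolding H_def by (intro le1 n1) (simp add: adj_simps adjE algebra_simps)
  define F where "F = e - c *\<^sub>R (e * (e * e) - 2 *\<^sub>R (e * e) + e)"
  have F: "emb F = f"
    by (simp add: F_def f_def G_def E_def emb_simps algebra_simps scaleR_2)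
  have FM: "F \<in> M"
    unfolding F_def by (intro masa_diff[OF M] masa_scaleR[OF M] masa_add[OF M] masa_mult[OF M] e)
  have "Pos (emb F - emb u)" if u: "u \<in> D" for u
  proof -
    have uM: "u \<in> M"
      using u D by blast
    have cH: "emb u * H = H * emb u" and cf: "emb u * f = f * emb u" and cE: "E * H = H * E"
      using com[OF uM] commute_mult[OF com[OF uM, symmetric] com[OF uM, symmetric]]
        com[OF FM] masa_emb_commute[OF M uM FM]
      by (simp_all add: H_def algebra_simps flip: F)
    have left_com: "E * (emb u * X) = emb u * (E * X)" for X
      by (metis com[OF uM] mult.assoc)
    \<comment> \<open>Both summands are products of commuting positive elements, so \<open>f\<close>
      is an upper bound of \<open>D\<close>.\<close>
    have "f - emb u = f * (1 - emb u) + (E * emb u - emb u) * H"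
      using com[OF uM] left_com by (simp add: H_def f_def G_def algebra_simps)
    moreover have "Pos (f * (1 - emb u) + (E * emb u - emb u) * H)"
      using cf cH cE commute_mult[of H E "emb u"]
      by (intro Pos_add Pos_mult Pf D_le_1 EU PH u) (simp_all add: algebra_simps)
    ultimately show ?thesis
      by (simp add: F)
  qed
  then have "Pos (emb F - emb e)"
    using FM Pf by (intro least) (auto simp flip: F intro: Pos_emb_st)
  then have "Pos (- (c *\<^sub>R (E * G)))"
    by (simp add: F f_def E_def)
  then have EG0: "E * G = 0"
    using Pos_antisym[of "c *\<^sub>R (E * G)"] Pos_scaleR[OF PEG, of c] c by simp
  have "adj (E * E - E) * (E * E - E) = E * G * E"
    by (simp add: adj_simps adjE G_def algebra_simps)
  then have EE: "E * E = E"
    using adj_mult_self_eq_0[of "E * E - E"] EG0 by simp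
  then have ee: "e * e = e"
    by (simp add: E_def flip: emb_simps)
  show thesis
  proof
    show "e * u = u" if u: "u \<in> D" for u
    proof -
      have "Pos ((1 - E) * emb u)"
        using com[of u] u D Pos_1_diff_proj[OF ee e(2)]
        by (intro Pos_mult Pos_D) (auto simp: E_def algebra_simps)
      then have "E * emb u - emb u = 0"
        using EU[OF u] by (intro Pos_antisym) (simp_all add: algebra_simps)
      then show ?thesis
        by (simp add: E_def flip: emb_simps)
    qed
    show "e * q = 0" if q: "q \<in> M" "Pos (emb q)" and uq: "\<And>u. u \<in> D \<Longrightarrow> u * q = 0" for q
    proof -
      define d where "d = 1 / (norm (emb q) + 1)"
      have d: "0 < d"
        by (simp add: d_def add_nonneg_pos)
      have Pq: "Pos (1 - d *\<^sub>R emb q)"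
        unfolding d_def by (rule Pos_1_diff_scaleR[OF q(2)])
      \<comment> \<open>Because \<open>u * q = 0\<close>, the difference to \<open>u\<close> is the
        product of \<open>e - u\<close> and \<open>1 - d q\<close>. Thus \<open>e - d e q\<close> is
        an upper bound too, and leastness of \<open>e\<close> gives
        \<open>e * q = 0\<close>.\<close>
      have "Pos (emb (e - d *\<^sub>R (e * q)) - emb e)"
      proof (rule least)
        show "e - d *\<^sub>R (e * q) \<in> M"
          by (intro masa_diff[OF M] masa_scaleR[OF M] masa_mult[OF M] e q)
        show "st (e - d *\<^sub>R (e * q)) = e - d *\<^sub>R (e * q)"
          using masa_commute[OF M e(1) q(1)]
          by (simp add: st_diff st_scaleR st_mult e Pos_emb_st q)
        fix u assume u: "u \<in> D"
        then have uM: "u \<in> M"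
          using D by blast
        have "emb u * emb q = 0" "emb q * emb u = 0"
          using uq[OF u] masa_commute[OF M uM q(1)] by (simp_all add: emb_simps flip: emb_simps(5))
        moreover from this have "Pos ((E - emb u) * (1 - d *\<^sub>R emb q))"
          using com[OF q(1)] up[OF u]
          by (intro Pos_mult Pq) (simp_all add: E_def algebra_simps)
        ultimately show "Pos (emb (e - d *\<^sub>R (e * q)) - emb u)"
          by (simp add: E_def algebra_simps emb_simps)
      qed
      then have "Pos (- (d *\<^sub>R (E * emb q)))"
        by (simp add: emb_simps E_def)
      moreover have "Pos (d *\<^sub>R (E * emb q))"
        using d by (intro Pos_scaleR Pos_mult PE q com) simp
      ultimately have "d *\<^sub>R (E * emb q) = 0"
        by (intro Pos_antisym)
      then have "emb (e * q) = 0"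
        using d by (simp add: E_def emb_simps)
      then show ?thesis
        by simp
    qed
  qed (fact e ee)+
qed

text \<open>The support projection of \<open>b\<close> is the supremum of the elements \<open>1 - (1 - b)\<^sup>n\<close>.\<close>

lemma support_projection_contraction:
  assumes M: "masa sc st M" and mc: "monotone_complete st M"
    and b: "b \<in> M" "Pos (emb b)" "Pos (1 - emb b)"
  obtains e where "e \<in> M" "e * e = e" "st e = e" "e * b = b"
    "\<And>q. q \<in> M \<Longrightarrow> Pos (emb q) \<Longrightarrow> b * q = 0 \<Longrightarrow> e * q = 0"
proof -
  define B where "B = emb b"
  define W where "W = (\<lambda>n. 1 - (1 - B) ^ n)"
  define u where "u = (\<lambda>n. elt (W n))"
  have u: "emb (u n) = W n" for n
    unfolding u_def by (rule emb_elt) (simp add: W_def B_def)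
  have comB: "B * (1 - B) ^ n = (1 - B) ^ n * B" for n
    by (rule dcomm_commute) (intro dcomm_intros)
  have W_Suc: "W (Suc n) = W n + B * (1 - B) ^ n" for n
    by (simp add: W_def algebra_simps)
  have PB: "Pos (B * (1 - B) ^ n)" "Pos ((1 - B) ^ n)" for n
    using b by (auto simp: B_def intro!: Pos_mult Pos_power comB[unfolded B_def])
  have mono: "Pos (W n - W m)" if "m \<le> n" for m n
    using that
  proof (induction n rule: dec_induct)
    case (step n)
    then show ?case
      using Pos_add[OF step.IH PB(1)[of n]] by (simp add: W_Suc algebra_simps)
  qed (simp add: Pos_0)
  obtain e where e: "e \<in> M" "e * e = e" "st e = e" "\<And>x. x \<in> range u \<Longrightarrow> e * x = x"
    "\<And>q. q \<in> M \<Longrightarrow> Pos (emb q) \<Longrightarrow> (\<And>x. x \<in> range u \<Longrightarrow> x * q = 0) \<Longrightarrow> e * q = 0"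
  proof (rule sup_projection[OF M mc])
    have "dcomm (emb b) (W n)" for n
      unfolding W_def B_def by (intro dcomm_intros)
    then have "elt (W n) \<in> M" for n
      by (rule masa_dcomm[OF M b(1)]) (simp add: W_def B_def)
    then show "range u \<subseteq> M"
      by (auto simp: u_def)
    fix x assume "x \<in> range u"
    then obtain m where m: "x = u m"
      by blast
    show "Pos (emb x)"
      using mono[of 0 m] by (simp add: m u) (simp add: W_def)
    show "Pos (1 - emb x)"
      using PB(2) by (simp add: m u W_def)
    show "\<exists>z\<in>range u. Pos (emb z - emb x) \<and> Pos (emb z - emb y)" if y: "y \<in> range u" for y
    proof -
      obtain n where "y = u n"
        using y by blast
      then show ?thesis
        using mono[of m "max m n"] mono[of n "max m n"]
        by (intro bexI[of _ "u (max m n)"]) (simp_all add: m u)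
    qed
    show "\<exists>v. (\<forall>n::nat. v n \<in> range u) \<and> (\<lambda>n. v n * x) \<longlonglongrightarrow> x"
    proof (intro exI conjI)
      \<comment> \<open>Since \<open>x\<close> is a multiple of \<open>B\<close>, the error
        \<open>u n * x - x\<close> contains the factor \<open>B * (1 - B) ^ n\<close>, which
        \<open>bnd_mult_power\<close> makes small.\<close>
      have "\<exists>S. W m = B * S"
      proof (induction m)
        case (Suc k)
        then show ?case
          unfolding W_Suc by (metis distrib_left)
      qed (auto simp: W_def intro: exI[of _ 0])
      then obtain S where S: "W m = B * S" ..
      have "norm (u n * x - x) \<le> (3 * norm S) * (1 / real n)" if "n \<ge> 1" for n
      proof -
        have "emb (u n * x - x) = - (B * (1 - B) ^ n * S)"
          by (simp add: m emb_simps u S comB) (simp add: W_def algebra_simps comB)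
        then have "norm (u n * x - x) = norm (B * (1 - B) ^ n * S)"
          by (metis norm_emb norm_minus_cancel)
        also have "\<dots> \<le> norm (B * (1 - B) ^ n) * norm S"
          by (rule norm_mult_ineq)
        also have "\<dots> \<le> (3 * (1 / real n)) * norm S"
          using b that by (intro mult_right_mono norm_le_of_bnd bnd_mult_power) (auto simp: B_def)
        finally show ?thesis
          by (simp add: mult_ac)
      qed
      then have "eventually (\<lambda>n. norm (u n * x - x) \<le> (3 * norm S) * (1 / real n)) sequentially"
        using eventually_sequentially by blast
      moreover have "(\<lambda>n. (3 * norm S) * (1 / real n)) \<longlonglongrightarrow> 0"
        by (intro tendsto_mult_right_zero lim_1_over_n)
      ultimately have "(\<lambda>n. u n * x - x) \<longlonglongrightarrow> 0"
        by (rule Lim_null_comparison)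
      then show "(\<lambda>n. u n * x) \<longlonglongrightarrow> x"
        by (rule LIM_zero_cancel)
    qed auto
  qed auto
  show thesis
  proof
    have "u 1 = b"
      by (simp add: u_def W_def B_def)
    then show "e * b = b"
      using e(4) by blast
    show "e * q = 0" if q: "q \<in> M" "Pos (emb q)" "b * q = 0" for q
    proof (rule e(5)[OF q(1,2)])
      have Bq: "B * emb q = 0"
        using q(3) by (simp add: B_def flip: emb_simps)
      have "W n * emb q = 0" for n
      proof (induction n)
        case (Suc n)
        then show ?case
          by (simp add: W_Suc comB algebra_simps Bq)
      qed (simp add: W_def)
      then have "emb (u n * q) = 0" for n
        by (simp add: emb_simps u)
      then show "x * q = 0" if "x \<in> range u" for x
        using that by auto
    qed
  qed (fact e)+
qed

lemma support_projection:
  assumes M: "masa sc st M" and mc: "monotone_complete st M" and b: "b \<in> M" "Pos (emb b)"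
  obtains e where "e \<in> M" "e * e = e" "st e = e" "e * b = b"
    "\<And>q. q \<in> M \<Longrightarrow> Pos (emb q) \<Longrightarrow> b * q = 0 \<Longrightarrow> e * q = 0"
proof -
  define r where "r = 1 / (norm (emb b) + 1)"
  have r: "0 < r"
    by (simp add: r_def add_nonneg_pos)
  have "r *\<^sub>R b \<in> M" "Pos (emb (r *\<^sub>R b))"
    using b r by (auto simp: emb_simps intro: masa_scaleR[OF M] Pos_scaleR)
  moreover have "Pos (1 - emb (r *\<^sub>R b))"
    unfolding r_def emb_simps by (rule Pos_1_diff_scaleR[OF b(2)])
  ultimately obtain e where e: "e \<in> M" "e * e = e" "st e = e" "e * (r *\<^sub>R b) = r *\<^sub>R b"
    "\<And>q. q \<in> M \<Longrightarrow> Pos (emb q) \<Longrightarrow> (r *\<^sub>R b) * q = 0 \<Longrightarrow> e * q = 0"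
    using support_projection_contraction[OF M mc] by metis
  then show thesis
    using r by (intro that[of e]) auto
qed

section \<open>Orthogonal families of projections\<close>

definition orth :: "'a set \<Rightarrow> bool"
  where "orth P \<longleftrightarrow> P \<subseteq> projections st \<and> (\<forall>p\<in>P. \<forall>q\<in>P. p \<noteq> q \<longrightarrow> p * q = 0)"

lemma orthD:
  assumes "orth P" "p \<in> P"
  shows "p * p = p" "st p = p" "q \<in> P \<Longrightarrow> p \<noteq> q \<Longrightarrow> p * q = 0"
  using assms by (auto simp: orth_def projections_def)

lemma orth_sum_mult:
  assumes "orth P" "finite F" "F \<subseteq> P" "p \<in> P"
  shows "\<Sum>F * p = (if p \<in> F then p else 0)" "p * \<Sum>F = (if p \<in> F then p else 0)"
proof -
  have "q * p = (if q = p then p else 0)" "p * q = (if q = p then p else 0)" if "q \<in> F" for q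
    using assms that orthD by (auto simp: subset_eq)
  then have "(\<Sum>q\<in>F. q * p) = (\<Sum>q\<in>F. if q = p then p else 0)"
    "(\<Sum>q\<in>F. p * q) = (\<Sum>q\<in>F. if q = p then p else 0)"
    by (intro sum.cong refl; simp)+
  then show "\<Sum>F * p = (if p \<in> F then p else 0)" "p * \<Sum>F = (if p \<in> F then p else 0)"
    using assms by (simp_all add: sum_distrib_left sum_distrib_right)
qed

lemma orth_sum_projection:
  assumes "orth P" "finite F" "F \<subseteq> P"
  shows "\<Sum>F * \<Sum>F = \<Sum>F" "st (\<Sum>F) = \<Sum>F"
proof -
  have "\<Sum>F * \<Sum>F = (\<Sum>p\<in>F. p * \<Sum>F)"
    by (simp add: sum_distrib_right)
  also have "\<dots> = \<Sum>F"
    using assms orth_sum_mult(2)[OF assms] by (intro sum.cong) auto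
  finally show "\<Sum>F * \<Sum>F = \<Sum>F" .
  show "st (\<Sum>F) = \<Sum>F"
    unfolding st_sum using assms orthD by (intro sum.cong) auto
qed

text \<open>The finite partial sums are directed, and each of them is a projection, so the constant
  sequence serves as its approximate unit.\<close>

lemma sup_orthogonal_family:
  assumes M: "masa sc st M" and mc: "monotone_complete st M" and P: "orth P" "P \<subseteq> M"
  obtains e where "e \<in> M" "e * e = e" "st e = e" "\<And>p. p \<in> P \<Longrightarrow> e * p = p"
    "\<And>q. q \<in> M \<Longrightarrow> Pos (emb q) \<Longrightarrow> (\<And>p. p \<in> P \<Longrightarrow> p * q = 0) \<Longrightarrow> e * q = 0"
proof -
  define D where "D = {\<Sum>F |F. finite F \<and> F \<subseteq> P}"
  obtain e where e: "e \<in> M" "e * e = e" "st e = e" "\<And>u. u \<in> D \<Longrightarrow> e * u = u"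
    "\<And>q. q \<in> M \<Longrightarrow> Pos (emb q) \<Longrightarrow> (\<And>u. u \<in> D \<Longrightarrow> u * q = 0) \<Longrightarrow> e * q = 0"
  proof (rule sup_projection[OF M mc])
    show "D \<subseteq> M"
      using P by (auto simp: D_def intro!: masa_sum[OF M])
    show "D \<noteq> {}"
      by (auto simp: D_def)
    fix x assume "x \<in> D"
    then obtain F where F: "x = \<Sum>F" "finite F" "F \<subseteq> P"
      by (auto simp: D_def)
    note x = orth_sum_projection[OF P(1) F(2,3), folded F(1)]
    show "Pos (emb x)" "Pos (1 - emb x)"
      using x by (auto intro: Pos_proj Pos_1_diff_proj)
    show "\<exists>v. (\<forall>n::nat. v n \<in> D) \<and> (\<lambda>n. v n * x) \<longlonglongrightarrow> x"
      using \<open>x \<in> D\<close> by (intro exI[of _ "\<lambda>_. x"]) (simp add: x)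
    show "\<exists>z\<in>D. Pos (emb z - emb x) \<and> Pos (emb z - emb y)" if y: "y \<in> D" for y
    proof -
      obtain F' where F': "y = \<Sum>F'" "finite F'" "F' \<subseteq> P"
        using y by (auto simp: D_def)
      have "Pos (emb (\<Sum>(F \<union> F')) - emb (\<Sum>K))" if "K \<subseteq> F \<union> F'" for K
      proof -
        have "\<Sum>(F \<union> F') - \<Sum>K = \<Sum>((F \<union> F') - K)"
          using F F' that by (simp add: sum_diff)
        moreover have "Pos (emb (\<Sum>((F \<union> F') - K)))"
          using F F' by (intro Pos_proj orth_sum_projection[OF P(1)]) auto
        ultimately show ?thesis
          by (simp flip: emb_simps)
      qed
      moreover have "\<Sum>(F \<union> F') \<in> D"
        unfolding D_def using F F' by blast
      ultimately show ?thesis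
        using F F' by blast
    qed
  qed auto
  show thesis
  proof
    show "e * p = p" if "p \<in> P" for p
    proof -
      have "\<Sum>{p} \<in> D"
        unfolding D_def using that by (intro CollectI exI[of _ "{p}"]) simp
      then show ?thesis
        using e(4)[of "\<Sum>{p}"] by simp
    qed
    show "e * q = 0" if q: "q \<in> M" "Pos (emb q)" "\<And>p. p \<in> P \<Longrightarrow> p * q = 0" for q
    proof (rule e(5)[OF q(1,2)])
      fix u assume "u \<in> D"
      then show "u * q = 0"
        using q(3) by (auto simp: D_def sum_distrib_right subset_eq intro!: sum.neutral)
    qed
  qed (fact e)+
qed

lemma ex_maximal_orth:
  assumes "orth P"
  obtains R where "orth R" "P \<subseteq> R" "\<And>R'. orth R' \<Longrightarrow> R \<subseteq> R' \<Longrightarrow> R' = R"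
proof -
  define \<A> where "\<A> = {R. orth R \<and> P \<subseteq> R}"
  have "\<Union>\<C> \<in> \<A>" if ne: "\<C> \<noteq> {}" and ch: "subset.chain \<A> \<C>" for \<C>
  proof -
    have mem: "orth N" "P \<subseteq> N" if "N \<in> \<C>" for N
      using ch that by (auto simp: subset_chain_def \<A>_def)
    have "p * q = 0" if "p \<in> N" "N \<in> \<C>" "q \<in> N'" "N' \<in> \<C>" "p \<noteq> q" for p q N N'
    proof -
      have "N \<subseteq> N' \<or> N' \<subseteq> N"
        using ch that by (simp add: subset_chain_def)
      then show ?thesis
        using orthD(3)[OF mem(1)] that by blast
    qed
    moreover have "\<Union>\<C> \<subseteq> projections st"
      using mem(1) by (auto simp: orth_def)
    moreover have "P \<subseteq> \<Union>\<C>"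
      using mem(2) ne by blast
    ultimately show ?thesis
      by (auto simp: \<A>_def orth_def)
  qed
  moreover have "P \<in> \<A>"
    using assms by (simp add: \<A>_def)
  ultimately obtain R where "R \<in> \<A>" "\<And>X. X \<in> \<A> \<Longrightarrow> R \<subseteq> X \<Longrightarrow> X = R"
    using subset_Zorn_nonempty[of \<A>] by blast
  then show thesis
    by (intro that[of R]) (auto simp: \<A>_def)
qed

section \<open>The unit and the AW*-property\<close>

lemma orth_masa:
  assumes "orth R"
  obtains M where "masa sc st M" "R \<subseteq> M"
proof (rule ex_masa)
  show "abelian R"
    unfolding abelian_def using orthD(3)[OF assms] by metis
  show "st x \<in> R" if "x \<in> R" for x
    using orthD(2)[OF assms that] that by simp
qed

text \<open>Dyadic expansion: with \<open>e\<close> the first digit of a contraction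
  \<open>x\<close>, the remainder \<open>2 x - e\<close> is again a contraction, so each digit
  halves the error. Scaling, positive and negative parts, and real and imaginary parts then reach
  all of \<open>M\<close>.\<close>

lemma masa_subset_of_projections_subset:
  assumes M: "masa sc st M" and mc: "monotone_complete st M"
    and u: "\<And>x. u * x = x \<and> x * u = (x :: 'a)"
    and B: "star_subalg sc st B" "closed B" "projections st \<inter> M \<subseteq> B"
  shows "M \<subseteq> B"
proof -
  have B_ops: "0 \<in> B" "x + y \<in> B" "r *\<^sub>R x \<in> B" "sc c x \<in> B" if "x \<in> B" "y \<in> B" for x y r c
    using B(1) that sc_of_real[of r x] unfolding star_subalg_def by metis+
  have "st u = u"
    using u[of "st u"] u[of u] by (metis st_mult st_st)
  then have uproj: "u * u = u" "st u = u"
    using u by auto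
  have uM: "u \<in> M"
    using u by (intro masa_commutant[OF M]) simp
  have contraction_approx: "\<exists>z\<in>B. norm (x - z) \<le> (1 / 2) ^ n"
    if "x \<in> M" "Pos (emb x)" "Pos (emb (u - x))" for x and n :: nat
    using that
  proof (induction n arbitrary: x)
    case 0
    have "Pos (1 - emb x)"
      using Pos_add[OF 0(3) Pos_1_diff_proj[OF uproj]] by (simp add: emb_simps)
    then have "norm x \<le> 1"
      using bnd_of_Pos[of "emb x" 1] 0 by (simp add: bnd_emb)
    then show ?case
      using B(1) by (intro bexI[of _ 0]) (auto simp: star_subalg_def)
  next
    case (Suc n)
    define h where "h = 2 *\<^sub>R x - u"
    have hM: "h \<in> M"
      unfolding h_def using Suc.prems by (intro masa_diff[OF M] masa_scaleR[OF M] uM)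
    have "adj (emb h) = emb h"
      using Suc.prems uproj by (simp add: adj_emb h_def st_diff st_scaleR Pos_emb_st)
    then obtain p m where pm: "Pos p" "Pos m" "emb h = p - m" "p * m = 0" "m * p = 0"
      "dcomm (emb h) p" "dcomm (emb h) m"
      using pos_neg_parts by blast
    have scl: "scl p = 0" "scl m = 0"
      using arg_cong[OF pm(3), of scl] arg_cong[OF pm(4), of scl] by auto
    define P Q where "P = elt p" and "Q = elt m"
    have embPQ: "emb P = p" "emb Q = m"
      by (simp_all add: P_def Q_def emb_elt scl)
    have PM: "P \<in> M" and QM: "Q \<in> M"
      using masa_dcomm[OF M hM] pm scl by (simp_all add: P_def Q_def)
    have "emb (P * Q) = 0" "emb h = emb (P - Q)"
      by (simp_all only: emb_simps(3,5) embPQ pm)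
    then have PQ: "P * Q = 0" "h = P - Q"
      by simp_all
    obtain e where e: "e \<in> M" "e * e = e" "st e = e" "e * P = P"
      "\<And>q. q \<in> M \<Longrightarrow> Pos (emb q) \<Longrightarrow> P * q = 0 \<Longrightarrow> e * q = 0"
      using support_projection[OF M mc PM] pm embPQ by metis
    have eQ: "e * Q = 0"
      using e(5)[OF QM] PQ pm embPQ by simp
    have eh: "e * h = P"
      by (simp add: PQ(2) algebra_simps eQ e)
    have ue: "(u - e) * (u - e) = u - e" "st (u - e) = u - e"
      using u e uproj by (simp_all add: algebra_simps st_diff)
    \<comment> \<open>This identity exhibits both \<open>x'\<close> and \<open>u - x'\<close> as
      sums of positive elements, namely \<open>P + 2 (u - e) x\<close> and
      \<open>Q + 2 e (u - x)\<close>.\<close>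
    have ex: "2 *\<^sub>R (e * x) = P + e"
      using eh u by (simp add: h_def algebra_simps)
    define x' where "x' = 2 *\<^sub>R x - e"
    have "x' = P + 2 *\<^sub>R ((u - e) * x)"
      using u ex by (simp add: x'_def algebra_simps)
    moreover have "Pos (emb (u - e) * emb x)"
      using Suc.prems e uM
      by (intro Pos_mult[OF Pos_proj[OF ue]] masa_emb_commute[OF M] masa_diff[OF M])
    ultimately have x'1: "Pos (emb x')"
      using pm(1) by (simp add: emb_simps embPQ Pos_add Pos_scaleR)
    have "u - x' = Q + 2 *\<^sub>R (e * (u - x))"
    proof -
      have "Q = P - 2 *\<^sub>R x + u"
        using PQ(2) by (simp add: h_def algebra_simps)
      then show ?thesis
        using u ex by (simp add: x'_def algebra_simps scaleR_2)
    qed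
    moreover have "Pos (emb e * emb (u - x))"
      using Suc.prems e uM
      by (intro Pos_mult[OF Pos_proj[OF e(2,3)]] masa_emb_commute[OF M] masa_diff[OF M])
    ultimately have x'2: "Pos (emb (u - x'))"
      using pm(2) by (simp only: emb_simps embPQ) (intro Pos_add Pos_scaleR; simp)
    have "x' \<in> M"
      unfolding x'_def using Suc.prems e by (intro masa_diff[OF M] masa_scaleR[OF M])
    then obtain z where z: "z \<in> B" "norm (x' - z) \<le> (1 / 2) ^ n"
      using Suc.IH x'1 x'2 by blast
    have "e \<in> B"
      using B(3) e by (auto simp: projections_def)
    then have "(1/2) *\<^sub>R (z + e) \<in> B"
      using B_ops z by blast
    moreover have "x - (1/2) *\<^sub>R (z + e) = (1/2) *\<^sub>R (x' - z)"
      by (simp add: x'_def algebra_simps)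
    then have "norm (x - (1/2) *\<^sub>R (z + e)) \<le> (1 / 2) ^ Suc n"
      using z(2) by simp
    ultimately show ?case
      by blast
  qed
  have Pos_contraction: "x \<in> B" if x: "x \<in> M" "Pos (emb x)" "Pos (emb (u - x))" for x
  proof -
    obtain z where z: "\<And>n. z n \<in> B" "\<And>n. norm (x - z n) \<le> (1 / 2) ^ n"
      using contraction_approx[OF x] by metis
    have "(\<lambda>n. (1 / 2 :: real) ^ n) \<longlonglongrightarrow> 0"
      by (rule LIMSEQ_realpow_zero) simp_all
    then have "(\<lambda>n. z n - x) \<longlonglongrightarrow> 0"
      by (rule Lim_null_comparison[rotated]) (simp add: z(2) norm_minus_commute)
    then have "z \<longlonglongrightarrow> x"
      by (rule LIM_zero_cancel)
    then show ?thesis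
      using closed_sequentially[OF B(2)] z(1) by blast
  qed
  have Pos_in_B: "x \<in> B" if x: "x \<in> M" "Pos (emb x)" for x
  proof -
    define r where "r = 1 / (norm (emb x) + 1)"
    have r: "0 < r"
      by (simp add: r_def add_nonneg_pos)
    have "Pos (1 - r *\<^sub>R emb x)"
      unfolding r_def by (rule Pos_1_diff_scaleR[OF x(2)])
    moreover have "(1 - r *\<^sub>R emb x) * emb u = emb (u - r *\<^sub>R x)"
      "emb u * (1 - r *\<^sub>R emb x) = emb (u - r *\<^sub>R x)"
      using u by (simp_all add: emb_simps algebra_simps flip: emb_simps(5))
    ultimately have "Pos (emb (u - r *\<^sub>R x))"
      using Pos_mult[of "1 - r *\<^sub>R emb x" "emb u"] Pos_proj[OF uproj] by simp
    then have "r *\<^sub>R x \<in> B"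
      using x r by (intro Pos_contraction masa_scaleR[OF M]) (simp_all add: emb_simps Pos_scaleR)
    then have "(1 / r) *\<^sub>R (r *\<^sub>R x) \<in> B"
      using B_ops by blast
    then show ?thesis
      using r by simp
  qed
  have sa_in_B: "x \<in> B" if x: "x \<in> M" "st x = x" for x
  proof -
    have "adj (emb x) = emb x"
      by (simp add: adj_emb x)
    then obtain p m where pm: "Pos p" "Pos m" "emb x = p - m" "p * m = 0" "dcomm (emb x) p"
      "dcomm (emb x) m"
      using pos_neg_parts by blast
    have scl: "scl p = 0" "scl m = 0"
      using arg_cong[OF pm(3), of scl] arg_cong[OF pm(4), of scl] by auto
    have "elt p \<in> B" "elt m \<in> B"
      using masa_dcomm[OF M x(1)] pm scl by (auto intro!: Pos_in_B simp: emb_elt)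
    moreover have "x = elt p + (-1) *\<^sub>R elt m"
      using arg_cong[OF pm(3), of elt] by simp
    ultimately show ?thesis
      using B_ops by metis
  qed
  show ?thesis
  proof
    fix x assume x: "x \<in> M"
    obtain a b where ab: "st a = a" "st b = b" "x = a + sc \<i> b"
      using real_imag_parts by blast
    have "a = (1/2) *\<^sub>R (x + st x)"
      by (simp add: ab st_add st_sc sc_minus_left flip: scaleR_2)
    then have aM: "a \<in> M"
      using masa_scaleR[OF M masa_add[OF M x masa_st[OF M x]]] by simp
    have "b = sc (- \<i>) (x - a)"
      by (simp add: ab sc_sc)
    then have "b \<in> M"
      using masa_sc[OF M masa_diff[OF M x aM]] by simp
    then have "a \<in> B" "b \<in> B"
      using aM ab sa_in_B by simp_all
    then have "a + sc \<i> b \<in> B"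
      using B_ops(2,4) by blast
    then show "x \<in> B"
      by (simp only: ab(3))
  qed
qed

section \<open>Maximal orthogonal families, the unit and suprema of projections\<close>

text \<open>The passage from one maximal abelian subalgebra to all of the algebra: \<open>x\<close>
  is arbitrary, and the subalgebra is chosen afterwards to contain \<open>R\<close> and
  \<open>st x * x\<close>.\<close>

lemma maximal_orth_faithful:
  assumes mc: "\<forall>M. masa sc st M \<longrightarrow> monotone_complete st M"
    and R: "orth R" and max: "\<And>R'. orth R' \<Longrightarrow> R \<subseteq> R' \<Longrightarrow> R' = R"
    and x: "\<And>p. p \<in> R \<Longrightarrow> x * p = 0"
  shows "x = 0"
proof -
  define b where "b = st x * x"
  have b: "Pos (emb b)" "st b = b"
    by (simp_all add: b_def Pos_star_mult st_mult)
  have bp: "b * p = 0" "p * b = 0" if "p \<in> R" for p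
  proof -
    show "b * p = 0"
      by (simp add: b_def mult.assoc x that)
    then have "st (b * p) = 0"
      by simp
    then show "p * b = 0"
      by (simp add: st_mult b orthD(2)[OF R that])
  qed
  have "p * q = q * p" if "p \<in> R" "q \<in> R" for p q
    using orthD(3)[OF R] that by metis
  then have "abelian (insert b R)"
    using bp by (auto simp: abelian_def)
  moreover have "st y \<in> insert b R" if "y \<in> insert b R" for y
    using that b orthD(2)[OF R] by auto
  ultimately obtain M where M: "masa sc st M" "insert b R \<subseteq> M"
    using ex_masa by blast
  obtain e where e: "e \<in> M" "e * e = e" "st e = e" "e * b = b"
    "\<And>q. q \<in> M \<Longrightarrow> Pos (emb q) \<Longrightarrow> b * q = 0 \<Longrightarrow> e * q = 0"
    using support_projection[OF M(1) _ _ b(1)] mc M by (metis insert_subset)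
  have ep: "e * p = 0" if "p \<in> R" for p
    using M that orthD[OF R that] bp by (intro e(5) Pos_proj) auto
  have pe: "p * e = 0" if "p \<in> R" for p
    using arg_cong[OF ep[OF that], of st] by (simp add: st_mult e orthD(2)[OF R that])
  \<comment> \<open>By maximality \<open>e\<close> already belongs to \<open>R\<close>; being
    orthogonal to all of \<open>R\<close> it satisfies \<open>e = e * e = 0\<close>.\<close>
  have "orth (insert e R)"
    using R e ep pe by (auto simp: orth_def projections_def)
  then have "e \<in> R"
    using max[of "insert e R"] by auto
  then have "e = 0"
    using ep e by metis
  then have "st x * x = 0"
    using e(4) by (simp add: b_def)
  then show ?thesis
    by (simp add: st_mult_self_eq_0)
qed

text \<open>If \<open>u * p = p\<close>, then \<open>u - p\<close> is a projection. Conversely,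
  compressing \<open>u - p\<close> by \<open>1 - u\<close> gives \<open>z* z = - y* y\<close> with
  \<open>y = p (1 - u)\<close>, which forces \<open>y = 0\<close>. The products are expanded so that
  no unit is required.\<close>

lemma cstar_le_projections:
  assumes p: "p * p = p" "st p = p" and u: "u * u = u" "st u = u"
  shows "cstar_le st p u \<longleftrightarrow> u * p = p"
proof
  assume up: "u * p = p"
  then have "st (u * p) = p"
    using p by simp
  then have "p * u = p"
    by (simp add: st_mult p u)
  then have "u - p = st (u - p) * (u - p)"
    using p u up by (simp add: st_diff algebra_simps)
  then show "cstar_le st p u"
    unfolding cstar_le_def positive_def by blast
next
  assume "cstar_le st p u"
  then obtain b where b: "u - p = st b * b"
    by (auto simp: cstar_le_def positive_def)
  define y z where "y = p - p * u" and "z = b - b * u"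
  have pp: "p * (p * x) = p * x" and uu: "u * (u * x) = u * x" for x
    by (simp_all add: p u flip: mult.assoc)
  have yy: "st y * y = p - p * u - u * p + u * p * u"
    by (simp add: y_def st_diff st_mult u p left_diff_distrib right_diff_distrib mult.assoc pp)
  have "st z * z = st b * b - st b * b * u - u * (st b * b) + u * (st b * b) * u"
    by (simp add: z_def st_diff st_mult u algebra_simps)
  also have "\<dots> = - (st y * y)"
    unfolding yy b[symmetric]
    by (simp add: u uu left_diff_distrib right_diff_distrib mult.assoc)
  finally have "Pos (- emb (st y * y))"
    using Pos_star_mult[of z] by (simp add: emb_simps)
  then have "emb (st y * y) = 0"
    using Pos_star_mult[of y] by (intro Pos_antisym)
  then have "y = 0"
    by (simp add: st_mult_self_eq_0)
  then have "st (p * u) = p"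
    using p by (simp add: y_def)
  then show "u * p = p"
    by (simp add: st_mult p u)
qed

lemma ex_unit:
  assumes mc: "\<forall>M. masa sc st M \<longrightarrow> monotone_complete st M"
  obtains u where "\<And>x. u * x = x \<and> x * u = (x :: 'a)"
proof -
  obtain R where R: "orth R" "\<And>R'. orth R' \<Longrightarrow> R \<subseteq> R' \<Longrightarrow> R' = R"
    using ex_maximal_orth[of "{}"] by (auto simp: orth_def)
  obtain M where M: "masa sc st M" "R \<subseteq> M"
    using orth_masa R by blast
  obtain u where u: "st u = u" "\<And>p. p \<in> R \<Longrightarrow> u * p = p"
    using sup_orthogonal_family[OF M(1) _ R(1) M(2)] mc M by metis
  have xu: "x * u = x" for x
  proof -
    have "x - x * u = 0"
      using u by (intro maximal_orth_faithful[OF mc R, of "x - x * u"])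
        (simp_all add: left_diff_distrib mult.assoc)
    then show ?thesis
      by simp
  qed
  have "u * x = x" for x
    using arg_cong[OF xu[of "st x"], of st] by (simp add: st_mult u)
  then show thesis
    by (intro that[of u]) (simp add: xu)
qed

lemma ex_sup_projections:
  assumes mc: "\<forall>M. masa sc st M \<longrightarrow> monotone_complete st M" and P: "orth P"
  obtains e where "is_sup_in (cstar_le st) (projections st) P e"
proof -
  obtain R where R: "orth R" "\<And>R'. orth R' \<Longrightarrow> R \<subseteq> R' \<Longrightarrow> R' = R" "P \<subseteq> R"
    using ex_maximal_orth[OF P] by metis
  obtain M where M: "masa sc st M" "R \<subseteq> M"
    using orth_masa R by blast
  then have "P \<subseteq> M"
    using R by blast
  then obtain e where e: "e * e = e" "st e = e" "\<And>p. p \<in> P \<Longrightarrow> e * p = p"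
    "\<And>q. q \<in> M \<Longrightarrow> Pos (emb q) \<Longrightarrow> (\<And>p. p \<in> P \<Longrightarrow> p * q = 0) \<Longrightarrow> e * q = 0"
    using sup_orthogonal_family[OF M(1) _ P] mc M by metis
  \<comment> \<open>For \<open>q\<close> in \<open>R\<close> outside \<open>P\<close> the product
    \<open>e * q\<close> vanishes, and for \<open>q\<close> in \<open>P\<close> it is
    \<open>q\<close>, which \<open>x\<close> kills. So \<open>x * e\<close> annihilates
    \<open>R\<close>, for any \<open>x\<close> of the algebra.\<close>
  have annihilate: "x * e = 0" if x: "\<And>p. p \<in> P \<Longrightarrow> x * p = 0" for x
  proof (rule maximal_orth_faithful[OF mc R(1,2)])
    fix q assume q: "q \<in> R"
    show "x * e * q = 0"
    proof (cases "q \<in> P")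
      case False
      then have "p * q = 0" if "p \<in> P" for p
        using orthD(3)[OF R(1)] that q R(3) by blast
      then have "e * q = 0"
        using M q orthD[OF R(1) q] by (intro e(4) Pos_proj) auto
      then show ?thesis
        by (simp add: mult.assoc)
    qed (simp add: mult.assoc e x)
  qed
  have "is_sup_in (cstar_le st) (projections st) P e"
    unfolding is_sup_in_def
  proof (intro conjI ballI impI)
    show "e \<in> projections st"
      by (simp add: projections_def e)
    show "cstar_le st p e" if "p \<in> P" for p
      using orthD[OF P that] e that by (simp add: cstar_le_projections)
    fix u assume "u \<in> projections st" and up: "\<forall>p\<in>P. cstar_le st p u"
    then have u: "u * u = u" "st u = u"
      by (simp_all add: projections_def)
    have "u * p = p" if "p \<in> P" for p
      using cstar_le_projections[OF orthD(1,2)[OF P that] u] up that by blast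
    \<comment> \<open>\<open>e - e * u\<close> kills \<open>P\<close> because
      \<open>e * u * p = e * p\<close>. The resulting \<open>e * u * e = e\<close> makes
      \<open>e - u * e\<close> vanish by the C*-identity.\<close>
    then have "(e - e * u) * e = 0"
      using e by (intro annihilate) (simp add: left_diff_distrib mult.assoc)
    then have eue: "e * u * e = e"
      by (simp add: left_diff_distrib e)
    have "st (e - u * e) * (e - u * e) = e - e * u * e - e * u * e + e * (u * u) * e"
      by (simp add: st_diff st_mult u(2) e(1,2) left_diff_distrib right_diff_distrib mult.assoc)
    then have "st (e - u * e) * (e - u * e) = 0"
      by (simp add: u(1) eue)
    then have "e - u * e = 0"
      by (simp only: st_mult_self_eq_0)
    then show "cstar_le st e u"
      using cstar_le_projections[OF e(1,2) u] by simp
  qed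
  then show thesis
    by (rule that)
qed

end

theorem theorem1p5:
  fixes sc :: "complex \<Rightarrow> 'a::{banach, real_normed_algebra} \<Rightarrow> 'a"
    and st :: "'a \<Rightarrow> 'a"
  assumes "cstar_algebra sc st"
    and "\<forall>M. masa sc st M \<longrightarrow> monotone_complete st M"
  shows "has_unit TYPE('a) \<and> aw_star sc st"
proof -
  interpret cstar sc st
    by unfold_locales (rule assms(1))
  obtain u :: 'a where u: "\<And>x. u * x = x \<and> x * u = x"
    using ex_unit[OF assms(2)] by metis
  have "M = cstar_generated sc st (projections st \<inter> M)" if M: "masa sc st M" for M
  proof
    show "M \<subseteq> cstar_generated sc st (projections st \<inter> M)"
      unfolding cstar_generated_def
      using masa_subset_of_projections_subset[OF M _ u] assms(2) M by blast
    show "cstar_generated sc st (projections st \<inter> M) \<subseteq> M"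
      unfolding cstar_generated_def using M masa_closed[OF M] by (auto simp: masa_def)
  qed
  moreover have "\<exists>e. is_sup_in (cstar_le st) (projections st) P e" if "orth P" for P
    using ex_sup_projections[OF assms(2) that] by blast
  ultimately have "aw_star sc st"
    unfolding aw_star_def orth_def by blast
  then show ?thesis
    using u unfolding has_unit_def by blast
qed

end
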